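(* Let $(M,g,I_1,I_2,I_3)$ be a locally conformally hyperkähler manifold whose Lee form $\theta$ is parallel with respect to the Levi-Civita connection of $g$ and has unit length with respect to $g$. Let $\theta_r=I_r\theta$ for $r=1,2,3$, and let $$\hat g=g-\tfrac12\{\theta\otimes\theta+\theta_1\otimes\theta_1+\theta_2\otimes\theta_2+\theta_3\otimes\theta_3\},$$ which is an HKT-metric with potential 1-form $-\theta$. Then this potential 1-form is parallel with respect to the HKT-connection $D$ of $\hat g$, i.e. $D\theta=0$.
   Context: A hypercomplex structure on a smooth manifold $M$ is a triple of integrable complex structures $I_1,I_2,I_3$ with $I_1^2=I_2^2=I_3^2=-\mathrm{Id}$ and $I_1I_2=I_3=-I_2I_1$. With a Riemannian metric $g$ satisfying $g(I_rX,I_rY)=g(X,Y)$ for $r=1,2,3$, $(M,g,I_1,I_2,I_3)$ is called hyperhermitian. It is hyperkähler if the Levi-Civita connection $\nabla$ of $g$ satisfies $\nabla I_r=0$ for all $r$. It is locally conformally hyperkähler if there are an open cover $\{U_i\}$ and smooth functions $f_i$ on $U_i$ with $g|_{U_i}=e^{f_i}g_i$, where each $g_i$ is a hyperkähler metric on $U_i$ (with respect to $I_1,I_2,I_3$). The Lee form is the globally defined closed 1-form $\theta$ with $\theta|_{U_i}=df_i$; it satisfies $dF_r=\theta\wedge F_r$ for $F_r(X,Y)=g(I_rX,Y)$. An HKT-connection on a hyperhermitian manifold $(M,\hat g,I_1,I_2,I_3)$ is a linear connection $D$ with torsion tensor $T^D$ such that $D\hat g=0$, $DI_r=0$ for all $r$,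 and $c(X,Y,Z)=\hat g(T^D(X,Y),Z)$ is a 3-form. When it exists it is unique, and $\hat g$ is called an HKT-metric. For a $k$-form $\omega$: $(I_r\omega)(X_1,\dots,X_k)=(-1)^k\omega(I_rX_1,\dots,I_rX_k)$ and $d_r\omega=(-1)^kI_r\,d\,I_r\omega$. With $\hat F_r(X,Y)=\hat g(I_rX,Y)$, a 1-form $\omega$ is a potential 1-form for $\hat g$ if, with $\omega_r=I_r\omega$, $$\hat F_1=\tfrac12(d\omega_1+d_2\omega_3),\quad \hat F_2=\tfrac12(d\omega_2+d_3\omega_1),\quad \hat F_3=\tfrac12(d\omega_3+d_1\omega_2).$$ *)

theory Defs
  imports "HOL-Analysis.Analysis"
begin

section \<open>Smooth manifolds\<close>

fun Ck_on :: "nat \<Rightarrow> 'a::euclidean_space set \<Rightarrow> ('a \<Rightarrow> 'b::real_normed_vector) \<Rightarrow> bool" where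
  "Ck_on 0 S f \<longleftrightarrow> continuous_on S f"
| "Ck_on (Suc k) S f \<longleftrightarrow>
     (\<forall>x\<in>S. f differentiable (at x)) \<and>
     (\<forall>v. Ck_on k S (\<lambda>x. frechet_derivative f (at x) v))"

text \<open>Only used for open \<open>S\<close>.\<close>

definition smooth_on :: "'a::euclidean_space set \<Rightarrow> ('a \<Rightarrow> 'b::real_normed_vector) \<Rightarrow> bool" where
  "smooth_on S f \<longleftrightarrow> (\<forall>k. Ck_on k S f)"

type_synonym ('m, 'e) chart = "'m set \<times> ('m \<Rightarrow> 'e)"

abbreviation cdom :: "('m, 'e) chart \<Rightarrow> 'm set" where
  "cdom c \<equiv> fst c"

abbreviation cmap :: "('m, 'e) chart \<Rightarrow> 'm \<Rightarrow> 'e" where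
  "cmap c \<equiv> snd c"

definition cinv :: "('m, 'e) chart \<Rightarrow> 'e \<Rightarrow> 'm" where
  "cinv c = inv_into (cdom c) (cmap c)"

definition is_chart :: "('m::topological_space, 'e::euclidean_space) chart \<Rightarrow> bool" where
  "is_chart c \<longleftrightarrow> open (cdom c) \<and> open (cmap c ` cdom c) \<and>
     homeomorphism (cdom c) (cmap c ` cdom c) (cmap c) (cinv c)"

text \<open>
  The manifold is the whole type \<open>'m\<close>, modelled on \<open>'e\<close>; it is Hausdorff and second countable
  as soon as \<open>'m\<close> is of class \<open>t2_space\<close> and \<open>second_countable_topology\<close>.
\<close>

definition smooth_atlas :: "('m::topological_space, 'e::euclidean_space) chart set \<Rightarrow> bool" where
  "smooth_atlas A \<longleftrightarrow> (\<forall>c\<in>A. is_chart c) \<and> (\<Union>c\<in>A. cdom c) = UNIV \<and>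
     (\<forall>c\<in>A. \<forall>d\<in>A. smooth_on (cmap c ` (cdom c \<inter> cdom d)) (cmap d \<circ> cinv c))"

text \<open>
  \<open>pd c p v F\<close> is the derivative at \<open>p\<close> of \<open>F\<close>, read in the chart \<open>c\<close>, along the tangent vector
  whose components in \<open>c\<close> are \<open>v\<close>.
\<close>

definition pd :: "('m, 'e::euclidean_space) chart \<Rightarrow> 'm \<Rightarrow> 'e \<Rightarrow> ('m \<Rightarrow> 'b::real_normed_vector) \<Rightarrow> 'b" where
  "pd c p v F = frechet_derivative (F \<circ> cinv c) (at (cmap c p)) v"

definition smooth_in :: "('m, 'e::euclidean_space) chart \<Rightarrow> 'm set \<Rightarrow> ('m \<Rightarrow> 'b::real_normed_vector) \<Rightarrow> bool" where
  "smooth_in c U F \<longleftrightarrow> smooth_on (cmap c ` (U \<inter> cdom c)) (F \<circ> cinv c)"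

definition smooth_fun ::
  "('m, 'e::euclidean_space) chart set \<Rightarrow> 'm set \<Rightarrow> ('m \<Rightarrow> real) \<Rightarrow> bool" where
  "smooth_fun A U f \<longleftrightarrow> (\<forall>c\<in>A. smooth_in c U f)"

text \<open>First and second derivatives of the coordinate change from the chart \<open>c\<close> to the chart \<open>d\<close>.\<close>

definition jac :: "('m, 'e::euclidean_space) chart \<Rightarrow> ('m, 'e) chart \<Rightarrow> 'm \<Rightarrow> 'e \<Rightarrow> 'e" where
  "jac c d p v = pd c p v (cmap d)"

definition hess :: "('m, 'e::euclidean_space) chart \<Rightarrow> ('m, 'e) chart \<Rightarrow> 'm \<Rightarrow> 'e \<Rightarrow> 'e \<Rightarrow> 'e" where
  "hess c d p v w = pd c p v (\<lambda>q. jac c d q w)"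


section \<open>Tensor fields and linear connections\<close>

text \<open>
  A tensor field on an open set \<open>U\<close> is given by its components: \<open>T c p\<close> is the value at \<open>p\<close>
  expressed in the chart \<open>c\<close>, for every chart \<open>c\<close> of the atlas with \<open>p \<in> cdom c\<close>, and the
  components in different charts are related by the usual transformation law.  The values of \<open>T\<close>
  for other \<open>c\<close> and \<open>p\<close> are meaningless and never used.
\<close>

type_synonym ('m, 'e, 'b) cfield = "('m, 'e) chart \<Rightarrow> 'm \<Rightarrow> 'b"
type_synonym ('m, 'e) tensor1 = "('m, 'e, 'e \<Rightarrow> real) cfield"
type_synonym ('m, 'e) tensor2 = "('m, 'e, 'e \<Rightarrow> 'e \<Rightarrow> real) cfield"
type_synonym ('m, 'e) tensor3 = "('m, 'e, 'e \<Rightarrow> 'e \<Rightarrow> 'e \<Rightarrow> real) cfield"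
type_synonym ('m, 'e) endo = "('m, 'e, 'e \<Rightarrow> 'e) cfield"
type_synonym ('m, 'e) conn = "('m, 'e, 'e \<Rightarrow> 'e \<Rightarrow> 'e) cfield"

definition one_form :: "('m, 'e::euclidean_space) chart set \<Rightarrow> 'm set \<Rightarrow> ('m, 'e) tensor1 \<Rightarrow> bool" where
  "one_form A U \<alpha> \<longleftrightarrow> (\<forall>c\<in>A.
     (\<forall>p\<in>U \<inter> cdom c. linear (\<alpha> c p)) \<and>
     (\<forall>v. smooth_in c U (\<lambda>p. \<alpha> c p v)) \<and>
     (\<forall>d\<in>A. \<forall>p\<in>U \<inter> cdom c \<inter> cdom d. \<forall>v. \<alpha> d p (jac c d p v) = \<alpha> c p v))"

definition bilinear_field :: "('m, 'e::euclidean_space) chart set \<Rightarrow> 'm set \<Rightarrow> ('m, 'e) tensor2 \<Rightarrow> bool" where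
  "bilinear_field A U \<beta> \<longleftrightarrow> (\<forall>c\<in>A.
     (\<forall>p\<in>U \<inter> cdom c. bilinear (\<beta> c p)) \<and>
     (\<forall>v w. smooth_in c U (\<lambda>p. \<beta> c p v w)) \<and>
     (\<forall>d\<in>A. \<forall>p\<in>U \<inter> cdom c \<inter> cdom d. \<forall>v w.
        \<beta> d p (jac c d p v) (jac c d p w) = \<beta> c p v w))"

definition three_form :: "('m, 'e::euclidean_space) chart set \<Rightarrow> 'm set \<Rightarrow> ('m, 'e) tensor3 \<Rightarrow> bool" where
  "three_form A U \<gamma> \<longleftrightarrow> (\<forall>c\<in>A.
     (\<forall>p\<in>U \<inter> cdom c.
        (\<forall>v. bilinear (\<gamma> c p v)) \<and> (\<forall>w z. linear (\<lambda>v. \<gamma> c p v w z)) \<and>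
        (\<forall>v w z. \<gamma> c p w v z = - \<gamma> c p v w z \<and> \<gamma> c p v z w = - \<gamma> c p v w z)) \<and>
     (\<forall>v w z. smooth_in c U (\<lambda>p. \<gamma> c p v w z)) \<and>
     (\<forall>d\<in>A. \<forall>p\<in>U \<inter> cdom c \<inter> cdom d. \<forall>v w z.
        \<gamma> d p (jac c d p v) (jac c d p w) (jac c d p z) = \<gamma> c p v w z))"

definition endo_field :: "('m, 'e::euclidean_space) chart set \<Rightarrow> 'm set \<Rightarrow> ('m, 'e) endo \<Rightarrow> bool" where
  "endo_field A U J \<longleftrightarrow> (\<forall>c\<in>A.
     (\<forall>p\<in>U \<inter> cdom c. linear (J c p)) \<and>
     (\<forall>v. smooth_in c U (\<lambda>p. J c p v)) \<and>
     (\<forall>d\<in>A. \<forall>p\<in>U \<inter> cdom c \<inter> cdom d. \<forall>v. J d p (jac c d p v) = jac c d p (J c p v)))"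

text \<open>
  A linear connection is given by its Christoffel symbols: \<open>\<Gamma> c p v w\<close> represents \<open>\<nabla>\<^sub>v W\<close> at \<open>p\<close>,
  where \<open>W\<close> is the local vector field with constant components \<open>w\<close> in the chart \<open>c\<close>.
\<close>

definition connection :: "('m, 'e::euclidean_space) chart set \<Rightarrow> 'm set \<Rightarrow> ('m, 'e) conn \<Rightarrow> bool" where
  "connection A U \<Gamma> \<longleftrightarrow> (\<forall>c\<in>A.
     (\<forall>p\<in>U \<inter> cdom c. bilinear (\<Gamma> c p)) \<and>
     (\<forall>v w. smooth_in c U (\<lambda>p. \<Gamma> c p v w)) \<and>
     (\<forall>d\<in>A. \<forall>p\<in>U \<inter> cdom c \<inter> cdom d. \<forall>v w.
        \<Gamma> d p (jac c d p v) (jac c d p w) = jac c d p (\<Gamma> c p v w) - hess c d p v w))"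

text \<open>
  Covariant derivative and Lie bracket of vector fields given by their components in \<open>c\<close>.  In the
  tensorial expressions below the arguments are extended to fields with constant components.
\<close>

definition cov :: "('m, 'e::euclidean_space) conn \<Rightarrow> ('m, 'e) chart \<Rightarrow> 'm \<Rightarrow> 'e \<Rightarrow> ('m \<Rightarrow> 'e) \<Rightarrow> 'e" where
  "cov \<Gamma> c p v Y = pd c p v Y + \<Gamma> c p v (Y p)"

definition lie :: "('m, 'e::euclidean_space) chart \<Rightarrow> 'm \<Rightarrow> ('m \<Rightarrow> 'e) \<Rightarrow> ('m \<Rightarrow> 'e) \<Rightarrow> 'e" where
  "lie c p X Y = pd c p (X p) Y - pd c p (Y p) X"

definition torsion :: "('m, 'e::euclidean_space) conn \<Rightarrow> ('m, 'e) conn" where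
  "torsion \<Gamma> = (\<lambda>c p v w.
     cov \<Gamma> c p v (\<lambda>_. w) - cov \<Gamma> c p w (\<lambda>_. v) - lie c p (\<lambda>_. v) (\<lambda>_. w))"

definition cov_form ::
  "('m, 'e::euclidean_space) conn \<Rightarrow> ('m, 'e) tensor1 \<Rightarrow> ('m, 'e) chart \<Rightarrow> 'm \<Rightarrow> 'e \<Rightarrow> 'e \<Rightarrow> real" where
  "cov_form \<Gamma> \<alpha> c p u v = pd c p u (\<lambda>q. \<alpha> c q v) - \<alpha> c p (cov \<Gamma> c p u (\<lambda>_. v))"

definition cov_bilinear ::
  "('m, 'e::euclidean_space) conn \<Rightarrow> ('m, 'e) tensor2 \<Rightarrow> ('m, 'e) chart \<Rightarrow> 'm \<Rightarrow> 'e \<Rightarrow> 'e \<Rightarrow> 'e \<Rightarrow> real" where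
  "cov_bilinear \<Gamma> \<beta> c p u v w = pd c p u (\<lambda>q. \<beta> c q v w)
     - \<beta> c p (cov \<Gamma> c p u (\<lambda>_. v)) w - \<beta> c p v (cov \<Gamma> c p u (\<lambda>_. w))"

definition cov_endo ::
  "('m, 'e::euclidean_space) conn \<Rightarrow> ('m, 'e) endo \<Rightarrow> ('m, 'e) chart \<Rightarrow> 'm \<Rightarrow> 'e \<Rightarrow> 'e \<Rightarrow> 'e" where
  "cov_endo \<Gamma> J c p u v = cov \<Gamma> c p u (\<lambda>q. J c q v) - J c p (cov \<Gamma> c p u (\<lambda>_. v))"

definition parallel_form ::
  "('m, 'e::euclidean_space) chart set \<Rightarrow> 'm set \<Rightarrow> ('m, 'e) conn \<Rightarrow> ('m, 'e) tensor1 \<Rightarrow> bool" where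
  "parallel_form A U \<Gamma> \<alpha> \<longleftrightarrow> (\<forall>c\<in>A. \<forall>p\<in>U \<inter> cdom c. \<forall>u v. cov_form \<Gamma> \<alpha> c p u v = 0)"

definition parallel_bilinear ::
  "('m, 'e::euclidean_space) chart set \<Rightarrow> 'm set \<Rightarrow> ('m, 'e) conn \<Rightarrow> ('m, 'e) tensor2 \<Rightarrow> bool" where
  "parallel_bilinear A U \<Gamma> \<beta> \<longleftrightarrow> (\<forall>c\<in>A. \<forall>p\<in>U \<inter> cdom c. \<forall>u v w. cov_bilinear \<Gamma> \<beta> c p u v w = 0)"

definition parallel_endo ::
  "('m, 'e::euclidean_space) chart set \<Rightarrow> 'm set \<Rightarrow> ('m, 'e) conn \<Rightarrow> ('m, 'e) endo \<Rightarrow> bool" where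
  "parallel_endo A U \<Gamma> J \<longleftrightarrow> (\<forall>c\<in>A. \<forall>p\<in>U \<inter> cdom c. \<forall>u v. cov_endo \<Gamma> J c p u v = 0)"


section \<open>Riemannian metrics\<close>

definition riemannian_metric ::
  "('m, 'e::euclidean_space) chart set \<Rightarrow> 'm set \<Rightarrow> ('m, 'e) tensor2 \<Rightarrow> bool" where
  "riemannian_metric A U g \<longleftrightarrow> bilinear_field A U g \<and>
     (\<forall>c\<in>A. \<forall>p\<in>U \<inter> cdom c.
        (\<forall>v w. g c p v w = g c p w v) \<and> (\<forall>v. v \<noteq> 0 \<longrightarrow> g c p v v > 0))"

definition levi_civita ::
  "('m, 'e::euclidean_space) chart set \<Rightarrow> 'm set \<Rightarrow> ('m, 'e) tensor2 \<Rightarrow> ('m, 'e) conn \<Rightarrow> bool" where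
  "levi_civita A U g \<Gamma> \<longleftrightarrow> connection A U \<Gamma> \<and> parallel_bilinear A U \<Gamma> g \<and>
     (\<forall>c\<in>A. \<forall>p\<in>U \<inter> cdom c. \<forall>v w. torsion \<Gamma> c p v w = 0)"

definition sharp :: "('m, 'e) tensor2 \<Rightarrow> ('m, 'e) tensor1 \<Rightarrow> ('m, 'e, 'e) cfield" where
  "sharp g \<alpha> c p = (THE v. \<forall>w. g c p v w = \<alpha> c p w)"

definition form_norm :: "('m, 'e) tensor2 \<Rightarrow> ('m, 'e) tensor1 \<Rightarrow> ('m, 'e, real) cfield" where
  "form_norm g \<alpha> c p = sqrt (g c p (sharp g \<alpha> c p) (sharp g \<alpha> c p))"


section \<open>Hypercomplex, hyperhermitian and (locally conformally) hyperkaehler structures\<close>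

definition nijenhuis :: "('m, 'e::euclidean_space) endo \<Rightarrow> ('m, 'e) conn" where
  "nijenhuis J c p v w =
     lie c p (\<lambda>q. J c q v) (\<lambda>q. J c q w) - J c p (lie c p (\<lambda>q. J c q v) (\<lambda>_. w))
     - J c p (lie c p (\<lambda>_. v) (\<lambda>q. J c q w)) - lie c p (\<lambda>_. v) (\<lambda>_. w)"

definition complex_structure ::
  "('m, 'e::euclidean_space) chart set \<Rightarrow> 'm set \<Rightarrow> ('m, 'e) endo \<Rightarrow> bool" where
  "complex_structure A U J \<longleftrightarrow> endo_field A U J \<and>
     (\<forall>c\<in>A. \<forall>p\<in>U \<inter> cdom c.
        (\<forall>v. J c p (J c p v) = - v) \<and> (\<forall>v w. nijenhuis J c p v w = 0))"

definition hypercomplex ::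
  "('m, 'e::euclidean_space) chart set \<Rightarrow> 'm set \<Rightarrow> ('m, 'e) endo \<Rightarrow> ('m, 'e) endo \<Rightarrow> ('m, 'e) endo \<Rightarrow> bool" where
  "hypercomplex A U I1 I2 I3 \<longleftrightarrow>
     complex_structure A U I1 \<and> complex_structure A U I2 \<and> complex_structure A U I3 \<and>
     (\<forall>c\<in>A. \<forall>p\<in>U \<inter> cdom c. \<forall>v.
        I1 c p (I2 c p v) = I3 c p v \<and> I3 c p v = - I2 c p (I1 c p v))"

definition hyperhermitian ::
  "('m, 'e::euclidean_space) chart set \<Rightarrow> 'm set \<Rightarrow> ('m, 'e) tensor2 \<Rightarrow>
    ('m, 'e) endo \<Rightarrow> ('m, 'e) endo \<Rightarrow> ('m, 'e) endo \<Rightarrow> bool" where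
  "hyperhermitian A U g I1 I2 I3 \<longleftrightarrow> hypercomplex A U I1 I2 I3 \<and> riemannian_metric A U g \<and>
     (\<forall>J\<in>{I1, I2, I3}. \<forall>c\<in>A. \<forall>p\<in>U \<inter> cdom c. \<forall>v w. g c p (J c p v) (J c p w) = g c p v w)"

definition hyperkaehler ::
  "('m, 'e::euclidean_space) chart set \<Rightarrow> 'm set \<Rightarrow> ('m, 'e) tensor2 \<Rightarrow>
    ('m, 'e) endo \<Rightarrow> ('m, 'e) endo \<Rightarrow> ('m, 'e) endo \<Rightarrow> bool" where
  "hyperkaehler A U g I1 I2 I3 \<longleftrightarrow> hyperhermitian A U g I1 I2 I3 \<and>
     (\<exists>\<Gamma>. levi_civita A U g \<Gamma> \<and> (\<forall>J\<in>{I1, I2, I3}. parallel_endo A U \<Gamma> J))"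

text \<open>The cover is indexed by its own members; \<open>f U\<close> and \<open>h U\<close> are only relevant on \<open>U\<close>.\<close>

definition lchk_cover ::
  "('m::topological_space, 'e::euclidean_space) chart set \<Rightarrow> ('m, 'e) tensor2 \<Rightarrow>
    ('m, 'e) endo \<Rightarrow> ('m, 'e) endo \<Rightarrow> ('m, 'e) endo \<Rightarrow>
    'm set set \<Rightarrow> ('m set \<Rightarrow> 'm \<Rightarrow> real) \<Rightarrow> ('m set \<Rightarrow> ('m, 'e) tensor2) \<Rightarrow> bool" where
  "lchk_cover A g I1 I2 I3 \<U> f h \<longleftrightarrow> \<Union>\<U> = UNIV \<and>
     (\<forall>U\<in>\<U>. open U \<and> smooth_fun A U (f U) \<and> hyperkaehler A U (h U) I1 I2 I3 \<and>
        (\<forall>c\<in>A. \<forall>p\<in>U \<inter> cdom c. \<forall>v w. g c p v w = exp (f U p) * h U c p v w))"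

definition lc_hyperkaehler ::
  "('m::topological_space, 'e::euclidean_space) chart set \<Rightarrow> ('m, 'e) tensor2 \<Rightarrow>
    ('m, 'e) endo \<Rightarrow> ('m, 'e) endo \<Rightarrow> ('m, 'e) endo \<Rightarrow> bool" where
  "lc_hyperkaehler A g I1 I2 I3 \<longleftrightarrow> hyperhermitian A UNIV g I1 I2 I3 \<and>
     (\<exists>\<U> f h. lchk_cover A g I1 I2 I3 \<U> f h)"

definition lee_form ::
  "('m::topological_space, 'e::euclidean_space) chart set \<Rightarrow> ('m, 'e) tensor2 \<Rightarrow>
    ('m, 'e) endo \<Rightarrow> ('m, 'e) endo \<Rightarrow> ('m, 'e) endo \<Rightarrow> ('m, 'e) tensor1 \<Rightarrow> bool" where
  "lee_form A g I1 I2 I3 \<theta> \<longleftrightarrow> one_form A UNIV \<theta> \<and>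
     (\<exists>\<U> f h. lchk_cover A g I1 I2 I3 \<U> f h \<and>
        (\<forall>U\<in>\<U>. \<forall>c\<in>A. \<forall>p\<in>U \<inter> cdom c. \<forall>v. \<theta> c p v = pd c p v (f U)))"


section \<open>HKT connections and potential 1-forms\<close>

definition hkt_connection ::
  "('m, 'e::euclidean_space) chart set \<Rightarrow> ('m, 'e) tensor2 \<Rightarrow>
    ('m, 'e) endo \<Rightarrow> ('m, 'e) endo \<Rightarrow> ('m, 'e) endo \<Rightarrow> ('m, 'e) conn \<Rightarrow> bool" where
  "hkt_connection A g I1 I2 I3 D \<longleftrightarrow> connection A UNIV D \<and> parallel_bilinear A UNIV D g \<and>
     (\<forall>J\<in>{I1, I2, I3}. parallel_endo A UNIV D J) \<and>
     three_form A UNIV (\<lambda>c p X Y Z. g c p (torsion D c p X Y) Z)"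

definition hkt_metric ::
  "('m, 'e::euclidean_space) chart set \<Rightarrow> ('m, 'e) tensor2 \<Rightarrow>
    ('m, 'e) endo \<Rightarrow> ('m, 'e) endo \<Rightarrow> ('m, 'e) endo \<Rightarrow> bool" where
  "hkt_metric A g I1 I2 I3 \<longleftrightarrow> hyperhermitian A UNIV g I1 I2 I3 \<and>
     (\<exists>D. hkt_connection A g I1 I2 I3 D)"

definition fund_form :: "('m, 'e) tensor2 \<Rightarrow> ('m, 'e) endo \<Rightarrow> ('m, 'e) tensor2" where
  "fund_form g J = (\<lambda>c p v w. g c p (J c p v) w)"

text \<open>
  The operators \<open>(J \<omega>)(X\<^sub>1, \<dots>, X\<^sub>k) = (-1)\<^sup>k \<omega>(J X\<^sub>1, \<dots>, J X\<^sub>k)\<close> for \<open>k = 1\<close> and \<open>k = 2\<close>, the exterior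
  derivative of 1-forms, and \<open>(-1)\<^sup>k J d J\<close> on 1-forms (\<open>k = 1\<close>).  The convention is
  \<open>d\<omega>(X, Y) = X (\<omega> Y) - Y (\<omega> X) - \<omega> [X, Y]\<close>, without a factor \<open>1/2\<close>.
\<close>

definition act1 :: "('m, 'e) endo \<Rightarrow> ('m, 'e) tensor1 \<Rightarrow> ('m, 'e) tensor1" where
  "act1 J \<omega> = (\<lambda>c p v. - \<omega> c p (J c p v))"

definition act2 :: "('m, 'e) endo \<Rightarrow> ('m, 'e) tensor2 \<Rightarrow> ('m, 'e) tensor2" where
  "act2 J \<omega> = (\<lambda>c p v w. \<omega> c p (J c p v) (J c p w))"

definition ext_d :: "('m, 'e::euclidean_space) tensor1 \<Rightarrow> ('m, 'e) tensor2" where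
  "ext_d \<omega> = (\<lambda>c p v w. pd c p v (\<lambda>q. \<omega> c q w) - pd c p w (\<lambda>q. \<omega> c q v)
     - \<omega> c p (lie c p (\<lambda>_. v) (\<lambda>_. w)))"

definition twisted_d :: "('m, 'e::euclidean_space) endo \<Rightarrow> ('m, 'e) tensor1 \<Rightarrow> ('m, 'e) tensor2" where
  "twisted_d J \<omega> = (\<lambda>c p v w. - act2 J (ext_d (act1 J \<omega>)) c p v w)"

definition potential_one_form ::
  "('m, 'e::euclidean_space) chart set \<Rightarrow> ('m, 'e) tensor2 \<Rightarrow>
    ('m, 'e) endo \<Rightarrow> ('m, 'e) endo \<Rightarrow> ('m, 'e) endo \<Rightarrow> ('m, 'e) tensor1 \<Rightarrow> bool" where
  "potential_one_form A g I1 I2 I3 \<omega> \<longleftrightarrow> one_form A UNIV \<omega> \<and>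
     (\<forall>c\<in>A. \<forall>p\<in>cdom c. \<forall>v w.
        fund_form g I1 c p v w
          = 1/2 * (ext_d (act1 I1 \<omega>) c p v w + twisted_d I2 (act1 I3 \<omega>) c p v w) \<and>
        fund_form g I2 c p v w
          = 1/2 * (ext_d (act1 I2 \<omega>) c p v w + twisted_d I3 (act1 I1 \<omega>) c p v w) \<and>
        fund_form g I3 c p v w
          = 1/2 * (ext_d (act1 I3 \<omega>) c p v w + twisted_d I1 (act1 I2 \<omega>) c p v w))"

end

theory Submission
  imports Defs
begin

text \<open>
  The local hyperkaehler metrics \<open>e\<^bsup>-f\<^esup> g\<close> all have the Weyl connection of \<open>(g, \<theta>)\<close> as Levi-Civita
  connection, so it is torsion free and preserves the three complex structures (it is the Obata
  connection).  This expresses the covariant derivatives of \<open>I\<^sub>r\<close>, and hence \<open>d\<theta>\<^sub>r\<close>, algebraically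
  in terms of \<open>g\<close>, \<open>I\<^sub>r\<close>, \<open>\<theta>\<close>.  Adding to \<open>\<nabla>\<close> an explicit tensor, built from \<open>\<theta>\<close>, \<open>I\<^sub>r\<close> and the
  vector field \<open>B\<close> dual to \<open>\<theta>\<close>, gives a connection \<open>D\<close> which preserves \<open>g\<close>, \<open>\<theta>\<close> and all \<open>I\<^sub>r\<close>, therefore
  also the new metric, and whose torsion is a 3-form.  So \<open>D\<close> is an HKT connection, and as such
  it is unique.
\<close>

section \<open>Smooth functions on open sets\<close>

lemma Ck_on_mono: "Ck_on (Suc k) S f \<Longrightarrow> Ck_on k S f"
proof (induction k arbitrary: f)
  case 0
  then show ?case
    by (auto intro!: differentiable_imp_continuous_on simp: differentiable_on_def differentiable_at_withinI)
qed auto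

lemma Ck_on_subset: "Ck_on k S f \<Longrightarrow> T \<subseteq> S \<Longrightarrow> Ck_on k T f"
  by (induction k arbitrary: f) (auto intro: continuous_on_subset)

text \<open>The derivative at a point sees only values on an open neighbourhood. This matters
  because component fields agree, and carry meaning, only on chart domains.\<close>

lemma frechet_derivative_cong:
  assumes "open S" "x \<in> S" "\<And>y. y \<in> S \<Longrightarrow> f y = f' y"
  shows "frechet_derivative f (at x) = frechet_derivative f' (at x)"
    and "f differentiable (at x) \<longleftrightarrow> f' differentiable (at x)"
proof -
  have "(f has_derivative D) (at x) \<longleftrightarrow> (f' has_derivative D) (at x)" for D
    using assms has_derivative_transform_within_open by (metis (no_types, lifting))
  then show "frechet_derivative f (at x) = frechet_derivative f' (at x)"
    and "f differentiable (at x) \<longleftrightarrow> f' differentiable (at x)"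
    by (auto simp: frechet_derivative_def differentiable_def)
qed

lemma Ck_on_cong:
  "open S \<Longrightarrow> (\<And>x. x \<in> S \<Longrightarrow> f x = f' x) \<Longrightarrow> Ck_on k S f \<longleftrightarrow> Ck_on k S f'"
proof (induction k arbitrary: f f')
  case 0
  then show ?case by (auto intro: continuous_on_cong)
next
  case (Suc k)
  have *: "frechet_derivative f (at x) v = frechet_derivative f' (at x) v"
    "f differentiable (at x) \<longleftrightarrow> f' differentiable (at x)" if "x \<in> S" for x v
    using frechet_derivative_cong[OF Suc.prems(1) that, of f f'] Suc.prems(2) by auto
  have "Ck_on k S (\<lambda>x. frechet_derivative f (at x) v) \<longleftrightarrow> Ck_on k S (\<lambda>x. frechet_derivative f' (at x) v)" for v
    by (rule Suc.IH) (use Suc.prems * in auto)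
  then show ?case using * by simp
qed

lemma Ck_on_Union:
  assumes "\<And>S. S \<in> \<S> \<Longrightarrow> open S" "\<And>S. S \<in> \<S> \<Longrightarrow> Ck_on k S f"
  shows "Ck_on k (\<Union>\<S>) f"
  using assms(2)
proof (induction k arbitrary: f)
  case 0
  then show ?case using assms(1) continuous_on_open_Union[of \<S> f] by auto
qed auto

lemma Ck_on_const: "Ck_on k S (\<lambda>_. c)"
  by (induction k arbitrary: c) auto

text \<open>Replaces \<open>frechet_derivative\<close> by any explicit derivative \<open>D\<close>,
  so that the closure properties below can be read off the usual differentiation rules.\<close>

lemma Ck_on_SucI:
  assumes "open S" and D: "\<And>x. x \<in> S \<Longrightarrow> (f has_derivative D x) (at x)"
    and "\<And>v. Ck_on k S (\<lambda>x. D x v)"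
  shows "Ck_on (Suc k) S f"
proof -
  have "frechet_derivative f (at x) v = D x v" if "x \<in> S" for x v
    using frechet_derivative_at[OF D[OF that]] by simp
  then have "Ck_on k S (\<lambda>x. frechet_derivative f (at x) v)" for v
    using Ck_on_cong[OF assms(1), of "\<lambda>x. frechet_derivative f (at x) v"] assms(3) by simp
  then show ?thesis using D by (auto simp: differentiable_def)
qed

lemma Ck_on_SucD: "Ck_on (Suc k) S f \<Longrightarrow> x \<in> S \<Longrightarrow> (f has_derivative frechet_derivative f (at x)) (at x)"
  by (auto simp flip: frechet_derivative_works)

lemma Ck_on_add: "open S \<Longrightarrow> Ck_on k S f \<Longrightarrow> Ck_on k S f' \<Longrightarrow> Ck_on k S (\<lambda>x. f x + f' x)"
proof (induction k arbitrary: f f')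
  case 0
  then show ?case by (auto intro: continuous_on_add)
next
  case (Suc k)
  show ?case
    by (rule Ck_on_SucI[OF Suc.prems(1) has_derivative_add[OF Ck_on_SucD Ck_on_SucD]])
       (use Suc in auto)
qed

text \<open>Induction through the Leibniz rule: each summand of the derivative pairs one
  undifferentiated factor with one derivative, and \<open>Ck_on_mono\<close> lowers the order of the
  former. Products, scalar multiples and inner products are all instances.\<close>

lemma Ck_on_bilinear:
  assumes "bounded_bilinear b"
  shows "open S \<Longrightarrow> Ck_on k S f \<Longrightarrow> Ck_on k S f' \<Longrightarrow> Ck_on k S (\<lambda>x. b (f x) (f' x))"
proof (induction k arbitrary: f f')
  case 0
  then show ?case using bounded_bilinear.continuous_on[OF assms] by auto
next
  case (Suc k)
  note mono = Ck_on_mono[OF Suc.prems(2)] Ck_on_mono[OF Suc.prems(3)]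
  show ?case
    by (rule Ck_on_SucI[OF Suc.prems(1) bounded_bilinear.FDERIV[OF assms Ck_on_SucD Ck_on_SucD]])
       (use Suc mono in \<open>auto intro!: Ck_on_add\<close>)
qed

text \<open>The derivative of \<open>1/f\<close> is \<open>- (1/f) * Df * (1/f)\<close>, a product
  of \<open>Df\<close> with \<open>1/f\<close> itself, so the induction hypothesis for the same
  \<open>f\<close> suffices.\<close>

lemma Ck_on_inverse:
  fixes f :: "'a::euclidean_space \<Rightarrow> real"
  assumes "open S" "Ck_on k S f" "\<And>x. x \<in> S \<Longrightarrow> f x \<noteq> 0"
  shows "Ck_on k S (\<lambda>x. inverse (f x))"
  using assms(2)
proof (induction k)
  case 0
  then show ?case using assms by (auto intro!: continuous_on_inverse)
next
  case (Suc k)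
  note m = Ck_on_bilinear[OF bounded_bilinear_mult assms(1)]
  have D: "((\<lambda>x. inverse (f x)) has_derivative
      (\<lambda>v. - 1 * (inverse (f x) * frechet_derivative f (at x) v * inverse (f x)))) (at x)" if "x \<in> S" for x
    using Deriv.has_derivative_inverse[OF _ Ck_on_SucD[OF Suc.prems that]] that assms(3) by simp
  have *: "Ck_on k S (\<lambda>x. - 1 * (inverse (f x) * frechet_derivative f (at x) v * inverse (f x)))" for v
    by (intro m Ck_on_const Suc.IH Ck_on_mono[OF Suc.prems]) (use Suc.prems in auto)
  show ?case by (rule Ck_on_SucI[OF assms(1) D]) (assumption, rule *)
qed

section \<open>Calculus in a chart\<close>

lemma cinv_cmap: "is_chart c \<Longrightarrow> p \<in> cdom c \<Longrightarrow> cinv c (cmap c p) = p"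
  by (auto simp: is_chart_def homeomorphism_def)

lemma open_cmap_image:
  assumes "is_chart c" "open U"
  shows "open (cmap c ` (U \<inter> cdom c))"
proof -
  have "openin (top_of_set (cdom c)) (U \<inter> cdom c)"
    using assms(2) by (subst Int_commute) (rule openin_open_Int)
  then have "openin (top_of_set (cmap c ` cdom c)) (cmap c ` (U \<inter> cdom c))"
    using assms(1) homeomorphism_imp_open_map unfolding is_chart_def by blast
  then show ?thesis using assms(1) openin_open_trans unfolding is_chart_def by blast
qed

lemma pd_const [simp]: "pd c p v (\<lambda>_. a) = 0"
  by (simp add: pd_def comp_def frechet_derivative_const)

lemma pd_eqI: "((F \<circ> cinv c) has_derivative D) (at (cmap c p)) \<Longrightarrow> pd c p v F = D v"
  by (simp add: pd_def frechet_derivative_at[symmetric])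

text \<open>Reduces a point-dependent argument of a tensor field to the finitely many constant basis
  vectors, the only arguments for which smoothness of components is given.\<close>

lemma linear_expansion:
  fixes f :: "'e::euclidean_space \<Rightarrow> 'b::real_vector"
  assumes "linear f"
  shows "f y = (\<Sum>b\<in>Basis. (y \<bullet> b) *\<^sub>R f b)"
proof -
  have "f (\<Sum>b\<in>Basis. (y \<bullet> b) *\<^sub>R b) = (\<Sum>b\<in>Basis. (y \<bullet> b) *\<^sub>R f b)"
    by (simp only: linear_sum[OF assms] linear_scale[OF assms])
  then show ?thesis by (simp only: euclidean_representation)
qed

context
  fixes c :: "('m::topological_space, 'e::euclidean_space) chart" and U :: "'m set"
  assumes chart: "is_chart c" and "open U"
begin

lemma opn: "open (cmap c ` (U \<inter> cdom c))"
  using open_cmap_image[OF chart \<open>open U\<close>] .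

lemma smooth_in_cong:
  "(\<And>q. q \<in> U \<inter> cdom c \<Longrightarrow> F q = F' q) \<Longrightarrow> smooth_in c U F \<longleftrightarrow> smooth_in c U F'"
  unfolding smooth_in_def smooth_on_def
  by (intro all_cong1 Ck_on_cong opn) (auto simp: cinv_cmap[OF chart])

lemma pd_cong:
  assumes "p \<in> U \<inter> cdom c" "\<And>q. q \<in> U \<inter> cdom c \<Longrightarrow> F q = F' q"
  shows "pd c p v F = pd c p v F'"
proof -
  have "frechet_derivative (F \<circ> cinv c) (at (cmap c p)) = frechet_derivative (F' \<circ> cinv c) (at (cmap c p))"
    by (rule frechet_derivative_cong[OF opn]) (use assms in \<open>auto simp: cinv_cmap[OF chart]\<close>)
  then show ?thesis by (simp add: pd_def)
qed

lemma smooth_in_const: "smooth_in c U (\<lambda>_. a)"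
  by (simp add: smooth_in_def smooth_on_def comp_def Ck_on_const)

lemma smooth_in_add: "smooth_in c U F \<Longrightarrow> smooth_in c U F' \<Longrightarrow> smooth_in c U (\<lambda>q. F q + F' q)"
  unfolding smooth_in_def smooth_on_def comp_def by (intro allI Ck_on_add[OF opn]) simp_all

lemma smooth_in_bilinear:
  "bounded_bilinear b \<Longrightarrow> smooth_in c U F \<Longrightarrow> smooth_in c U F' \<Longrightarrow> smooth_in c U (\<lambda>q. b (F q) (F' q))"
  unfolding smooth_in_def smooth_on_def comp_def
  by (intro allI Ck_on_bilinear[of b, OF _ opn]) simp_all

lemmas smooth_in_mult = smooth_in_bilinear[OF bounded_bilinear_mult]
lemmas smooth_in_scaleR = smooth_in_bilinear[OF bounded_bilinear_scaleR]

lemma smooth_in_uminus: "smooth_in c U F \<Longrightarrow> smooth_in c U (\<lambda>q. - F q)"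
  using smooth_in_scaleR[OF smooth_in_const, of F "-1"] by simp

lemma smooth_in_diff: "smooth_in c U F \<Longrightarrow> smooth_in c U F' \<Longrightarrow> smooth_in c U (\<lambda>q. F q - F' q)"
  using smooth_in_add[OF _ smooth_in_uminus, of F F'] by simp

lemma smooth_in_inverse:
  fixes F :: "'m \<Rightarrow> real"
  assumes "smooth_in c U F" "\<And>q. q \<in> U \<inter> cdom c \<Longrightarrow> F q \<noteq> 0"
  shows "smooth_in c U (\<lambda>q. inverse (F q))"
  using assms unfolding smooth_in_def smooth_on_def comp_def
  by (auto intro!: Ck_on_inverse opn simp: cinv_cmap[OF chart])

lemma smooth_in_sum:
  "finite S \<Longrightarrow> (\<And>i. i \<in> S \<Longrightarrow> smooth_in c U (F i)) \<Longrightarrow> smooth_in c U (\<lambda>q. \<Sum>i\<in>S. F i q)"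
  by (induction S rule: finite_induct) (auto intro: smooth_in_const smooth_in_add)

lemma smooth_in_contract:
  fixes \<alpha> :: "'m \<Rightarrow> 'e \<Rightarrow> 'b::real_normed_vector"
  assumes "\<And>q. q \<in> U \<inter> cdom c \<Longrightarrow> linear (\<alpha> q)" "\<And>v. smooth_in c U (\<lambda>q. \<alpha> q v)" "smooth_in c U Y"
  shows "smooth_in c U (\<lambda>q. \<alpha> q (Y q))"
proof -
  have "smooth_in c U (\<lambda>q. \<Sum>b\<in>Basis. (Y q \<bullet> b) *\<^sub>R \<alpha> q b)"
    by (intro smooth_in_sum smooth_in_scaleR smooth_in_bilinear[OF bounded_bilinear_inner] smooth_in_const assms) auto
  moreover have "\<alpha> q (Y q) = (\<Sum>b\<in>Basis. (Y q \<bullet> b) *\<^sub>R \<alpha> q b)" if "q \<in> U \<inter> cdom c" for q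
    by (rule linear_expansion[OF assms(1)[OF that]])
  ultimately show ?thesis
    using smooth_in_cong[of "\<lambda>q. \<alpha> q (Y q)" "\<lambda>q. \<Sum>b\<in>Basis. (Y q \<bullet> b) *\<^sub>R \<alpha> q b"] by blast
qed

lemma has_pd:
  assumes "smooth_in c U F" "p \<in> U \<inter> cdom c"
  shows "((F \<circ> cinv c) has_derivative (\<lambda>v. pd c p v F)) (at (cmap c p))"
  unfolding pd_def using assms Ck_on_SucD[of 0]
  unfolding smooth_in_def smooth_on_def by blast

lemma linear_pd: "smooth_in c U F \<Longrightarrow> p \<in> U \<inter> cdom c \<Longrightarrow> linear (\<lambda>v. pd c p v F)"
  using has_pd has_derivative_linear by blast

lemma pd_add:
  assumes "smooth_in c U F" "smooth_in c U F'" "p \<in> U \<inter> cdom c"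
  shows "pd c p v (\<lambda>q. F q + F' q) = pd c p v F + pd c p v F'"
  using has_derivative_add[OF has_pd[OF assms(1,3)] has_pd[OF assms(2,3)]]
  by (intro pd_eqI) (simp add: comp_def)

lemma pd_bilinear:
  assumes "bounded_bilinear b" "smooth_in c U F" "smooth_in c U F'" "p \<in> U \<inter> cdom c"
  shows "pd c p v (\<lambda>q. b (F q) (F' q)) = b (F p) (pd c p v F') + b (pd c p v F) (F' p)"
  using bounded_bilinear.FDERIV[OF assms(1) has_pd[OF assms(2,4)] has_pd[OF assms(3,4)]] assms(4)
  by (intro pd_eqI) (simp add: comp_def cinv_cmap[OF chart])

lemmas pd_mult = pd_bilinear[OF bounded_bilinear_mult]

lemma pd_cmult:
  assumes "smooth_in c U F" "p \<in> U \<inter> cdom c"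
  shows "pd c p v (\<lambda>q. a *\<^sub>R F q) = a *\<^sub>R pd c p v F"
  using pd_bilinear[OF bounded_bilinear_scaleR smooth_in_const assms] by simp

lemma pd_uminus:
  assumes "smooth_in c U F" "p \<in> U \<inter> cdom c"
  shows "pd c p v (\<lambda>q. - F q) = - pd c p v F"
  using pd_cmult[OF assms, of v "-1"] by simp

lemma pd_diff:
  assumes "smooth_in c U F" "smooth_in c U F'" "p \<in> U \<inter> cdom c"
  shows "pd c p v (\<lambda>q. F q - F' q) = pd c p v F - pd c p v F'"
  using pd_add[OF assms(1) smooth_in_uminus[OF assms(2)] assms(3), of v] assms by (simp add: pd_uminus)

lemma has_pd_exp:
  assumes "smooth_in c U f" "p \<in> U \<inter> cdom c"
  shows "((\<lambda>q. exp (f q :: real)) \<circ> cinv c has_derivative (\<lambda>v. exp (f p) * pd c p v f)) (at (cmap c p))"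
  using has_derivative_exp[OF has_pd[OF assms]] assms(2)
  by (simp add: comp_def cinv_cmap[OF chart] mult.commute)

text \<open>Leibniz rule for a contraction: one term freezes the argument at \<open>p\<close>, the
  other differentiates it.\<close>

lemma pd_contract:
  fixes \<alpha> :: "'m \<Rightarrow> 'e \<Rightarrow> 'b::real_normed_vector"
  assumes "\<And>q. q \<in> U \<inter> cdom c \<Longrightarrow> linear (\<alpha> q)" "\<And>v. smooth_in c U (\<lambda>q. \<alpha> q v)" "smooth_in c U Y"
    and p: "p \<in> U \<inter> cdom c"
  shows "pd c p u (\<lambda>q. \<alpha> q (Y q)) = pd c p u (\<lambda>q. \<alpha> q (Y p)) + \<alpha> p (pd c p u Y)"
proof -
  \<comment> \<open>Stated for every smooth \<open>Z\<close> because it is used twice: for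
    \<open>Y\<close>, and for the constant field \<open>Y p\<close>, whose derivative vanishes.
    Comparing the two instances eliminates the basis sum.\<close>
  have *: "pd c p u (\<lambda>q. \<alpha> q (Z q)) = (\<Sum>b\<in>Basis. (Z p \<bullet> b) *\<^sub>R pd c p u (\<lambda>q. \<alpha> q b)) + \<alpha> p (pd c p u Z)"
    if Z: "smooth_in c U Z" for Z
  proof -
    have s: "smooth_in c U (\<lambda>q. Z q \<bullet> b)" for b
      by (intro smooth_in_bilinear[OF bounded_bilinear_inner] smooth_in_const Z)
    have "((\<lambda>q. \<Sum>b\<in>Basis. (Z q \<bullet> b) *\<^sub>R \<alpha> q b) \<circ> cinv c has_derivative
       (\<lambda>u. \<Sum>b\<in>Basis. (Z p \<bullet> b) *\<^sub>R pd c p u (\<lambda>q. \<alpha> q b) + pd c p u (\<lambda>q. Z q \<bullet> b) *\<^sub>R \<alpha> p b)) (at (cmap c p))"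
      using has_derivative_sum[of Basis, OF has_derivative_scaleR[OF has_pd[OF s p] has_pd[OF assms(2) p]]] p
      by (simp add: comp_def cinv_cmap[OF chart])
    note D = pd_eqI[OF this, of u]
    have inner: "pd c p u (\<lambda>q. Z q \<bullet> b) = pd c p u Z \<bullet> b" for b
      using pd_bilinear[OF bounded_bilinear_inner Z smooth_in_const p] by simp
    have "pd c p u (\<lambda>q. \<alpha> q (Z q)) = pd c p u (\<lambda>q. \<Sum>b\<in>Basis. (Z q \<bullet> b) *\<^sub>R \<alpha> q b)"
      by (rule pd_cong[OF p]) (rule linear_expansion[OF assms(1)])
    also note D
    also have "(\<Sum>b\<in>Basis. (Z p \<bullet> b) *\<^sub>R pd c p u (\<lambda>q. \<alpha> q b) + pd c p u (\<lambda>q. Z q \<bullet> b) *\<^sub>R \<alpha> p b)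
        = (\<Sum>b\<in>Basis. (Z p \<bullet> b) *\<^sub>R pd c p u (\<lambda>q. \<alpha> q b)) + \<alpha> p (pd c p u Z)"
      unfolding inner sum.distrib linear_expansion[OF assms(1)[OF p], symmetric] ..
    finally show ?thesis .
  qed
  have const: "pd c p u (\<lambda>q. \<alpha> q (Y p)) = (\<Sum>b\<in>Basis. (Y p \<bullet> b) *\<^sub>R pd c p u (\<lambda>q. \<alpha> q b))"
    by (rule trans[OF *[OF smooth_in_const]]) (simp only: pd_const linear_0[OF assms(1)[OF p]] add_0_right)
  show ?thesis by (rule trans[OF *[OF assms(3)]]) (simp only: const)
qed

end

text \<open>Smoothness is local: the chart images of the members are open and cover the image of the
  union. It globalises what is known only on each member of the hyperkaehler cover.\<close>

lemma smooth_in_Union: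
  assumes "is_chart c" "\<And>U. U \<in> \<U> \<Longrightarrow> open U" "\<And>U. U \<in> \<U> \<Longrightarrow> smooth_in c U F"
  shows "smooth_in c (\<Union>\<U>) F"
proof -
  have "cmap c ` (\<Union>\<U> \<inter> cdom c) = \<Union>((\<lambda>U. cmap c ` (U \<inter> cdom c)) ` \<U>)" by auto
  moreover have "Ck_on k (\<Union>((\<lambda>U. cmap c ` (U \<inter> cdom c)) ` \<U>)) (F \<circ> cinv c)" for k
    by (rule Ck_on_Union)
       (use assms open_cmap_image[OF assms(1)] in \<open>auto simp: smooth_in_def smooth_on_def\<close>)
  ultimately show ?thesis by (simp add: smooth_in_def smooth_on_def)
qed

lemma smooth_in_subset: "smooth_in c V F \<Longrightarrow> U \<subseteq> V \<Longrightarrow> smooth_in c U F"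
  unfolding smooth_in_def smooth_on_def by (blast intro: Ck_on_subset)

lemma cov_const [simp]: "cov \<Gamma> c p u (\<lambda>_. v) = \<Gamma> c p u v"
  by (simp add: cov_def)

lemma lie_const [simp]: "lie c p (\<lambda>_. v) (\<lambda>_. w) = 0"
  by (simp add: lie_def)

lemma linear_jac:
  assumes "smooth_atlas A" "c \<in> A" "d \<in> A" "p \<in> cdom c \<inter> cdom d"
  shows "linear (jac c d p)"
proof -
  have "smooth_on (cmap c ` (cdom c \<inter> cdom d)) (cmap d \<circ> cinv c)"
    using assms by (auto simp: smooth_atlas_def)
  then have "smooth_in c (cdom d) (cmap d)" by (simp add: smooth_in_def Int_commute)
  then show ?thesis using linear_pd[of c "cdom d" "cmap d" p] assms
    unfolding jac_def smooth_atlas_def is_chart_def by auto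
qed

section \<open>Linear algebra in a tangent space\<close>

text \<open>Lowering an index, \<open>E\<close> is a 3-form that is invariant under \<open>J\<close> in any two slots.
  Applying \<open>J\<close> in the first two and then in the last two slots gives \<open>e(u, v, w) = e(J u, J\<^sup>2 v, J w) =
  - e(J u, v, J w) = - e(u, v, w)\<close>.\<close>

lemma skew_torsion_unique:
  fixes h :: "'e::euclidean_space \<Rightarrow> 'e \<Rightarrow> real"
  assumes "bilinear h" and sym: "\<And>v w. h v w = h w v" and pos: "\<And>v. v \<noteq> 0 \<Longrightarrow> h v v > 0"
    and skew: "\<And>u v w. h (E u v) w + h v (E u w) = 0"
    and torsion: "\<And>u v w. h (E u v - E v u) w = - h (E u w - E w u) v"
    and neg: "\<And>u v. E u (- v) = - E u v"
    and J: "\<And>u v. E u (J v) = J (E u v)" "\<And>v w. h (J v) (J w) = h v w" "\<And>v. J (J v) = - v"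
  shows "E u v = 0"
proof -
  define e where "e u v w = h (E u v) w" for u v w
  have s23: "e u v w = - e u w v" for u v w
    using skew[of u v w] by (simp add: e_def sym[of v])
  have s13: "e u v w = - e w v u" for u v w
    using torsion[of v u w] s23[of v u w] by (simp add: e_def bilinear_lsub[OF assms(1)])
  have J23: "e u (J v) (J w) = e u v w" for u v w
    by (simp add: e_def J)
  have J13: "e (J u) v (J w) = e u v w" for u v w
    using J23[of v u w] s13 s23 by metis
  have J12: "e (J u) (J v) w = e u v w" for u v w
    using J23[of w u v] s13 s23 by metis
  have "e u v w = - e u v w" for u v w
  proof -
    have "e u v w = e (J u) (J (J v)) (J w)" by (simp only: J12 J23)
    also have "\<dots> = - e (J u) v (J w)" by (simp add: e_def J(3) neg bilinear_lneg[OF assms(1)])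
    finally show ?thesis by (simp add: J13)
  qed
  then have "h (E u v) (E u v) = 0" by (metis e_def add.inverse_neutral neg_equal_zero)
  then show ?thesis using pos[of "E u v"] by fastforce
qed

text \<open>Makes the definite description in \<open>sharp\<close> meaningful. The map
  \<open>?L\<close> lists the values of \<open>h v\<close> on the basis; positivity makes it
  injective, hence surjective by dimension.\<close>

lemma riesz:
  fixes h :: "'e::euclidean_space \<Rightarrow> 'e \<Rightarrow> real"
  assumes "bilinear h" and pos: "\<And>v. v \<noteq> 0 \<Longrightarrow> h v v > 0" and "linear \<alpha>"
  shows "\<exists>!v. \<forall>w. h v w = \<alpha> w"
proof -
  let ?L = "\<lambda>v. \<Sum>b\<in>Basis. h v b *\<^sub>R b"
  have basis_ext: "\<alpha> = \<beta>" if "linear \<alpha>" "linear \<beta>" "\<And>b. b \<in> Basis \<Longrightarrow> \<alpha> b = \<beta> b" for \<alpha> \<beta> :: "'e \<Rightarrow> real"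
    using that linear_eq_stdbasis by blast
  have lh: "linear (h v)" for v using assms(1) by (simp add: bilinear_def)
  have L: "?L v \<bullet> b = h v b" if "b \<in> Basis" for v b
    using that by (simp add: inner_sum_left inner_Basis if_distrib cong: if_cong)
  have linL: "linear ?L"
    by (rule linearI) (simp_all add: bilinear_ladd[OF assms(1)] bilinear_lmul[OF assms(1)]
        algebra_simps sum.distrib scaleR_sum_right)
  have "inj ?L"
    unfolding linear_injective_0[OF linL]
  proof safe
    fix v assume "?L v = 0"
    then have "h v b = 0" if "b \<in> Basis" for b using L[OF that, of v] by simp
    then have "h v = (\<lambda>_. 0)" by (intro basis_ext lh) (auto simp: linear_zero)
    then show "v = 0" using pos[of v] by fastforce
  qed
  then obtain v where v: "?L v = (\<Sum>b\<in>Basis. \<alpha> b *\<^sub>R b)"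
    using surjD[OF linear_injective_imp_surjective[OF linL \<open>inj ?L\<close>]] by (metis (no_types))
  have "h v = \<alpha>"
    by (rule basis_ext[OF lh assms(3)])
       (use L[of _ v] v in \<open>simp add: inner_sum_left inner_Basis if_distrib cong: if_cong\<close>)
  show ?thesis
  proof (rule ex1I)
    show "\<forall>w. h v w = \<alpha> w" by (simp add: \<open>h v = \<alpha>\<close>)
    fix v' assume *: "\<forall>w. h v' w = \<alpha> w"
    have "h (v' - v) (v' - v) = 0"
      using * by (simp add: bilinear_lsub[OF assms(1)] \<open>h v = \<alpha>\<close>)
    then show "v' = v" using pos[of "v' - v"] by (cases "v' - v = 0") auto
  qed
qed

section \<open>Pointwise algebra of the metrics, the Weyl shift and the HKT shift\<close>

text \<open>The new metric on one tangent space. The signs in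
  \<open>\<theta>\<^sub>r = - \<theta> \<circ> I\<^sub>r\<close> cancel in the products.\<close>

definition hkt_ghat where
  "hkt_ghat g I1 I2 I3 \<theta> v w = g v w - 1/2 * (\<theta> v * \<theta> w + \<theta> (I1 v) * \<theta> (I1 w)
     + \<theta> (I2 v) * \<theta> (I2 w) + \<theta> (I3 v) * \<theta> (I3 w) :: real)"

text \<open>If \<open>g = e^f h\<close> and \<theta> is \<open>df\<close>, this is the Levi-Civita
  connection of \<open>g\<close> minus that of \<open>h\<close>.\<close>

definition weyl_shift :: "('e \<Rightarrow> 'e \<Rightarrow> real) \<Rightarrow> ('e \<Rightarrow> real) \<Rightarrow> 'e \<Rightarrow> 'e \<Rightarrow> 'e \<Rightarrow> 'e::real_vector" where
  "weyl_shift g \<theta> B v w = (1/2) *\<^sub>R (\<theta> v *\<^sub>R w + \<theta> w *\<^sub>R v - g v w *\<^sub>R B)"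

text \<open>
  With \<open>\<theta>\<^sub>r = - \<theta> \<circ> I\<^sub>r\<close>, this is the difference of the HKT connection and the Levi-Civita
  connection of \<open>g\<close>.  It is found by solving for a connection with \<open>D g = 0\<close> and \<open>D \<theta>\<^sub>r = 0\<close>; these
  suggest the torsion 3-form
  \<open>c = 1/2 (\<theta>\<^sub>1 \<and> d\<theta>\<^sub>1 + \<theta>\<^sub>2 \<and> d\<theta>\<^sub>2 + \<theta>\<^sub>3 \<and> d\<theta>\<^sub>3) + \<theta>\<^sub>1 \<and> \<theta>\<^sub>2 \<and> \<theta>\<^sub>3\<close>.
\<close>

definition hkt_shift :: "('e \<Rightarrow> 'e \<Rightarrow> real) \<Rightarrow> ('e \<Rightarrow> 'e) \<Rightarrow> ('e \<Rightarrow> 'e) \<Rightarrow> ('e \<Rightarrow> 'e) \<Rightarrow>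
    ('e \<Rightarrow> real) \<Rightarrow> 'e \<Rightarrow> 'e \<Rightarrow> 'e \<Rightarrow> 'e::real_vector" where
  "hkt_shift g I1 I2 I3 \<theta> B v w = (1/2) *\<^sub>R (
     (g v (I1 w) + \<theta> (I1 v) * \<theta> w + (\<theta> (I2 v) * \<theta> (I3 w) - \<theta> (I3 v) * \<theta> (I2 w))) *\<^sub>R I1 B
   + (g v (I2 w) + \<theta> (I2 v) * \<theta> w + (\<theta> (I3 v) * \<theta> (I1 w) - \<theta> (I1 v) * \<theta> (I3 w))) *\<^sub>R I2 B
   + (g v (I3 w) + \<theta> (I3 v) * \<theta> w + (\<theta> (I1 v) * \<theta> (I2 w) - \<theta> (I2 v) * \<theta> (I1 w))) *\<^sub>R I3 B
   + (\<theta> (I1 v) * \<theta> (I1 w) + \<theta> (I2 v) * \<theta> (I2 w) + \<theta> (I3 v) * \<theta> (I3 w)) *\<^sub>R B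
   - \<theta> (I1 w) *\<^sub>R I1 v - \<theta> (I2 w) *\<^sub>R I2 v - \<theta> (I3 w) *\<^sub>R I3 v)"

locale quaternionic_unit_covector =
  fixes g :: "'e::euclidean_space \<Rightarrow> 'e \<Rightarrow> real" and I1 I2 I3 :: "'e \<Rightarrow> 'e"
    and \<theta> :: "'e \<Rightarrow> real" and B :: 'e
  assumes bil: "bilinear g" and sym: "g v w = g w v" and pos: "v \<noteq> 0 \<Longrightarrow> g v v > 0"
    and lin: "linear I1" "linear I2" "linear I3" "linear \<theta>"
    and sq: "I1 (I1 v) = - v" "I2 (I2 v) = - v" "I3 (I3 v) = - v"
    and I12: "I1 (I2 v) = I3 v" and I21: "I2 (I1 v) = - I3 v"
    and herm: "g (I1 v) (I1 w) = g v w" "g (I2 v) (I2 w) = g v w" "g (I3 v) (I3 w) = g v w"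
    and gB: "g B w = \<theta> w" and unit: "\<theta> B = 1"
begin

lemmas lins = linear_add[OF lin(1)] linear_add[OF lin(2)] linear_add[OF lin(3)] linear_add[OF lin(4)]
  linear_diff[OF lin(1)] linear_diff[OF lin(2)] linear_diff[OF lin(3)] linear_diff[OF lin(4)]
  linear_neg[OF lin(1)] linear_neg[OF lin(2)] linear_neg[OF lin(3)] linear_neg[OF lin(4)]
  linear_scale[OF lin(1)] linear_scale[OF lin(2)] linear_scale[OF lin(3)] linear_scale[OF lin(4)]
  bilinear_ladd[OF bil] bilinear_radd[OF bil] bilinear_lsub[OF bil] bilinear_rsub[OF bil]
  bilinear_lneg[OF bil] bilinear_rneg[OF bil] bilinear_lmul[OF bil] bilinear_rmul[OF bil]

lemma quaternion:
  "I2 (I3 v) = I1 v" "I3 (I2 v) = - I1 v" "I3 (I1 v) = I2 v" "I1 (I3 v) = - I2 v"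
proof -
  show a: "I1 (I3 v) = - I2 v" using I12[of "I2 v"] sq lins by (metis I12)
  show "I2 (I3 v) = I1 v" using I21[of "I2 v"] sq lins I12[of v] I12[of "I2 v"] I21[of "I1 v"]
    by (metis add.inverse_inverse I21)
  show "I3 (I2 v) = - I1 v" using I12[of "I2 v"] sq lins by simp
  show "I3 (I1 v) = I2 v" using I12[of "I1 v"] I21[of v] a lins by simp
qed

lemma skew: "g (I1 v) w = - g v (I1 w)" "g (I2 v) w = - g v (I2 w)" "g (I3 v) w = - g v (I3 w)"
  using herm(1)[of v "I1 w"] herm(2)[of v "I2 w"] herm(3)[of v "I3 w"] by (simp_all add: sq lins)

lemma gB': "g w B = \<theta> w"
  by (simp add: gB sym[of w])

text \<open>\<open>g(I\<^sub>r B, B)\<close> changes sign when the slots are exchanged and is also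
  symmetric. Consequently \<open>B\<close>, \<open>I1 B\<close>, \<open>I2 B\<close>,
  \<open>I3 B\<close> are orthonormal for \<open>g\<close>.\<close>

lemma \<theta>_IB: "\<theta> (I1 B) = 0" "\<theta> (I2 B) = 0" "\<theta> (I3 B) = 0"
  using skew(1)[of B B] skew(2)[of B B] skew(3)[of B B] gB gB' by auto

lemma gIB: "g w (I1 B) = - \<theta> (I1 w)" "g w (I2 B) = - \<theta> (I2 w)" "g w (I3 B) = - \<theta> (I3 w)"
  using skew[of w B] by (simp_all add: gB')

lemmas point_simps = gIB lins sq I12 I21 quaternion skew gB gB' unit \<theta>_IB

abbreviation "ghat \<equiv> hkt_ghat g I1 I2 I3 \<theta>"
abbreviation "weyl \<equiv> weyl_shift g \<theta> B"
abbreviation "K \<equiv> hkt_shift g I1 I2 I3 \<theta> B"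

text \<open>In the \<open>B\<close> direction, the coefficient of \<open>B\<close> cancels against
  the three terms in \<open>I1 v\<close>, \<open>I2 v\<close>, \<open>I3 v\<close>; the
  \<open>I\<^sub>r B\<close> are killed by \<theta>. Hence adding \<open>K\<close> to a connection
  does not change the derivative of \<theta>.\<close>

lemma \<theta>_K: "\<theta> (K v w) = 0"
  unfolding hkt_shift_def by (simp add: point_simps algebra_simps add_divide_distrib)

text \<open>This is the condition for a connection compatible with \<open>g\<close> to stay so after
  adding \<open>K\<close>. The instances of \<open>sym\<close> bring opposite terms into the same
  form.\<close>

lemma K_skew: "g (K u v) w + g v (K u w) = 0"
  unfolding hkt_shift_def using sym[of v "I1 u"] sym[of v "I2 u"] sym[of v "I3 u"]
  by (simp add: point_simps algebra_simps add_divide_distrib)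

text \<open>Since the Levi-Civita connection minus \<open>weyl\<close> preserves the complex
  structures, adding \<open>K + weyl\<close> to it must preserve them too; that sum is the
  connection shifted by \<open>K\<close>.\<close>

lemma weyl_K_commutes:
  "K u (I1 v) + weyl u (I1 v) = I1 (K u v + weyl u v)"
  "K u (I2 v) + weyl u (I2 v) = I2 (K u v + weyl u v)"
  "K u (I3 v) + weyl u (I3 v) = I3 (K u v + weyl u v)"
  unfolding hkt_shift_def weyl_shift_def by (simp_all add: point_simps algebra_simps add_divide_distrib)

lemma K_bilinear: "bilinear K"
  unfolding hkt_shift_def by (simp add: bilinear_def linear_iff lins algebra_simps add_divide_distrib)

text \<open>The antisymmetrisation of \<open>K\<close> is the torsion of the shifted connection. Its
  antisymmetry in the first two slots is evident; this is the remaining condition for a 3-form, with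
  the index lowered by \<open>ghat\<close>.\<close>

lemma torsion_skew:
  "ghat (K u v - K v u) w = - ghat (K u w - K w u) v"
  unfolding hkt_shift_def hkt_ghat_def
  using sym[of v "I1 u"] sym[of v "I2 u"] sym[of v "I3 u"]
   sym[of w "I1 u"] sym[of w "I2 u"] sym[of w "I3 u"]
   sym[of w "I1 v"] sym[of w "I2 v"] sym[of w "I3 v"]
  by (simp add: point_simps algebra_simps add_divide_distrib)

lemma ghat_bilinear: "bilinear ghat"
  unfolding hkt_ghat_def by (simp add: bilinear_def linear_iff lins algebra_simps add_divide_distrib)

lemma ghat_sym: "ghat v w = ghat w v"
  unfolding hkt_ghat_def by (simp add: sym[of v w] algebra_simps)

lemma ghat_herm: "ghat (I1 v) (I1 w) = ghat v w" "ghat (I2 v) (I2 w) = ghat v w"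
  "ghat (I3 v) (I3 w) = ghat v w"
  unfolding hkt_ghat_def by (simp_all add: point_simps algebra_simps add_divide_distrib)

lemma ghat_pos: assumes "v \<noteq> 0" shows "ghat v v > 0"
proof -
  \<comment> \<open>\<open>w\<close> is the part of \<open>v\<close> that is
    \<open>g\<close>-orthogonal to \<open>B\<close>, \<open>I1 B\<close>, \<open>I2 B\<close>,
    \<open>I3 B\<close>; the signs come from \<open>gIB\<close>. Thus \<open>ghat v v\<close> is the
    mean of \<open>g v v\<close> and \<open>g w w\<close>.\<close>
  define w where "w = v - \<theta> v *\<^sub>R B + \<theta> (I1 v) *\<^sub>R I1 B + \<theta> (I2 v) *\<^sub>R I2 B + \<theta> (I3 v) *\<^sub>R I3 B"
  have "g w w \<ge> 0" using pos[of w] by (cases "w = 0") (auto simp: bilinear_lzero[OF bil])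
  moreover have "g w w = 2 * ghat v v - g v v"
    unfolding w_def hkt_ghat_def by (simp add: point_simps algebra_simps add_divide_distrib)
  ultimately show ?thesis using pos[OF assms] by simp
qed

text \<open>The potential equations at one point for \<open>\<omega> = - \<theta>\<close>. Here
  \<open>\<omega>\<^sub>r = \<theta> \<circ> I\<^sub>r\<close>, whose exterior derivative is
  \<open>\<theta> \<circ> I\<^sub>r\<close> of the antisymmetrised \<open>K\<close>. As
  \<open>I\<^sub>2 \<omega>\<^sub>3 = \<omega>\<^sub>1\<close>, and cyclically, the twisted term is
  the same 2-form on rotated arguments, with a minus sign.\<close>

lemma potential:
  "ghat (I1 v) w = 1/2 * (\<theta> (I1 (K v w - K w v)) - \<theta> (I1 (K (I2 v) (I2 w) - K (I2 w) (I2 v))))"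
  "ghat (I2 v) w = 1/2 * (\<theta> (I2 (K v w - K w v)) - \<theta> (I2 (K (I3 v) (I3 w) - K (I3 w) (I3 v))))"
  "ghat (I3 v) w = 1/2 * (\<theta> (I3 (K v w - K w v)) - \<theta> (I3 (K (I1 v) (I1 w) - K (I1 w) (I1 v))))"
  unfolding hkt_shift_def hkt_ghat_def
  using sym[of w "I1 v"] sym[of w "I2 v"] sym[of w "I3 v"]
  by (simp_all add: point_simps algebra_simps add_divide_distrib)

end

section \<open>The HKT connection\<close>

locale unit_parallel_lee =
  fixes A :: "('m::topological_space, 'e::euclidean_space) chart set"
    and g :: "('m, 'e) tensor2" and I1 I2 I3 :: "('m, 'e) endo"
    and \<theta> :: "('m, 'e) tensor1" and nabla :: "('m, 'e) conn"
  assumes atlas: "smooth_atlas A"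
    and herm: "hyperhermitian A UNIV g I1 I2 I3"
    and lee: "lee_form A g I1 I2 I3 \<theta>"
    and lc: "levi_civita A UNIV g nabla"
    and par: "parallel_form A UNIV nabla \<theta>"
    and norm: "\<forall>c\<in>A. \<forall>p\<in>cdom c. form_norm g \<theta> c p = 1"
begin

lemma chart: "c \<in> A \<Longrightarrow> is_chart c"
  using atlas by (simp add: smooth_atlas_def)

definition B :: "('m, 'e, 'e) cfield" where "B = sharp g \<theta>"

abbreviation weyl :: "('m, 'e) conn" where
  "weyl c p \<equiv> weyl_shift (g c p) (\<theta> c p) (B c p)"
abbreviation K :: "('m, 'e) conn" where
  "K c p \<equiv> hkt_shift (g c p) (I1 c p) (I2 c p) (I3 c p) (\<theta> c p) (B c p)"
definition ghat :: "('m, 'e) tensor2" where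
  "ghat c p v w = hkt_ghat (g c p) (I1 c p) (I2 c p) (I3 c p) (\<theta> c p) v w"
definition D :: "('m, 'e) conn" where
  "D c p v w = nabla c p v w + K c p v w"

lemma point:
  assumes "c \<in> A" "p \<in> cdom c"
  shows "quaternionic_unit_covector (g c p) (I1 c p) (I2 c p) (I3 c p) (\<theta> c p) (B c p)"
proof -
  have bil: "bilinear (g c p)" and sym: "\<And>v w. g c p v w = g c p w v"
    and pos: "\<And>v. v \<noteq> 0 \<Longrightarrow> g c p v v > 0"
    using herm assms by (auto simp: hyperhermitian_def riemannian_metric_def bilinear_field_def)
  have lin: "linear (\<theta> c p)"
    using lee assms by (auto simp: lee_form_def one_form_def)
  have gB: "g c p (B c p) w = \<theta> c p w" for w
    using theI'[OF riesz[OF bil pos lin]] unfolding B_def sharp_def by blast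
  \<comment> \<open>\<open>form_norm\<close> is the square root of \<open>g(B, B)\<close>, and
    \<open>g(B, B) = \<theta>(B)\<close>.\<close>
  then have "\<theta> c p (B c p) = 1"
    using norm assms unfolding form_norm_def B_def by force
  have hyp: "hypercomplex A UNIV I1 I2 I3" and J: "\<forall>J\<in>{I1, I2, I3}. \<forall>v w. g c p (J c p v) (J c p w) = g c p v w"
    using herm assms by (simp_all add: hyperhermitian_def)
  have I12: "I1 c p (I2 c p v) = I3 c p v" and I21: "I3 c p v = - I2 c p (I1 c p v)" for v
    using hyp assms by (simp_all add: hypercomplex_def)
  have cs: "linear (J c p) \<and> J c p (J c p v) = - v" if "complex_structure A UNIV J" for J v
    using that assms by (simp add: complex_structure_def endo_field_def)
  note cs' = cs[of I1] cs[of I2] cs[of I3]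
  show ?thesis
  proof (rule quaternionic_unit_covector.intro)
    show "I2 c p (I1 c p v) = - I3 c p v" for v using I21[of v] by simp
    show "g c p v w = g c p w v" for v w by (fact sym)
  qed (use cs' hyp J I12 bil pos lin gB \<open>\<theta> c p (B c p) = 1\<close> in \<open>simp_all add: hypercomplex_def\<close>)
qed

section \<open>Smoothness, linearity and first derivatives of the given tensors\<close>

lemma smooth_g: "c \<in> A \<Longrightarrow> smooth_in c UNIV (\<lambda>q. g c q v w)"
  using herm by (auto simp: hyperhermitian_def riemannian_metric_def bilinear_field_def)

lemma smooth_\<theta>: "c \<in> A \<Longrightarrow> smooth_in c UNIV (\<lambda>q. \<theta> c q v)"
  using lee by (auto simp: lee_form_def one_form_def)

lemma smooth_I: "c \<in> A \<Longrightarrow> J \<in> {I1, I2, I3} \<Longrightarrow> smooth_in c UNIV (\<lambda>q. J c q v)"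
  using herm by (auto simp: hyperhermitian_def hypercomplex_def complex_structure_def endo_field_def)

lemma smooth_nabla: "c \<in> A \<Longrightarrow> smooth_in c UNIV (\<lambda>q. nabla c q v w)"
  using lc by (auto simp: levi_civita_def connection_def)

lemma lin_I: "c \<in> A \<Longrightarrow> p \<in> cdom c \<Longrightarrow> J \<in> {I1, I2, I3} \<Longrightarrow> linear (J c p)"
  using quaternionic_unit_covector.lin[OF point, of c p] by (elim insertE) simp_all

lemma lin_\<theta>: "c \<in> A \<Longrightarrow> p \<in> cdom c \<Longrightarrow> linear (\<theta> c p)"
  by (rule quaternionic_unit_covector.lin(4)[OF point])

lemma bil_g: "c \<in> A \<Longrightarrow> p \<in> cdom c \<Longrightarrow> bilinear (g c p)"
  by (rule quaternionic_unit_covector.bil[OF point])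

lemma smooth_\<theta>I: "c \<in> A \<Longrightarrow> J \<in> {I1, I2, I3} \<Longrightarrow> smooth_in c UNIV (\<lambda>q. \<theta> c q (J c q v))"
  by (rule smooth_in_contract[OF chart open_UNIV]) (simp_all only: smooth_\<theta> smooth_I lin_\<theta> Int_iff)

lemma smooth_gI: "c \<in> A \<Longrightarrow> J \<in> {I1, I2, I3} \<Longrightarrow> smooth_in c UNIV (\<lambda>q. g c q u (J c q v))"
  by (rule smooth_in_contract[OF chart open_UNIV]) (simp_all only: smooth_g smooth_I bil_g[unfolded bilinear_def] Int_iff)

lemma pd_g: "c \<in> A \<Longrightarrow> p \<in> cdom c \<Longrightarrow>
    pd c p u (\<lambda>q. g c q v w) = g c p (nabla c p u v) w + g c p v (nabla c p u w)"
  using lc by (simp add: levi_civita_def parallel_bilinear_def cov_bilinear_def algebra_simps)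

lemma pd_\<theta>: "c \<in> A \<Longrightarrow> p \<in> cdom c \<Longrightarrow> pd c p u (\<lambda>q. \<theta> c q v) = \<theta> c p (nabla c p u v)"
  using par by (simp add: parallel_form_def cov_form_def)

lemma nabla_sym: "c \<in> A \<Longrightarrow> p \<in> cdom c \<Longrightarrow> nabla c p u v = nabla c p v u"
  using lc by (simp add: levi_civita_def torsion_def)

section \<open>The Weyl connection and the derivatives of the complex structures\<close>

text \<open>Koszul argument for the difference \<open>a\<close> of the two connections: it is
  symmetric because both are torsion free, and differentiating \<open>g = e^f h\<close> prescribes
  its symmetric part with respect to \<open>g\<close>.\<close>

lemma conformal_levi_civita:
  assumes U: "open U" "smooth_fun A U f" "riemannian_metric A U h" "levi_civita A U h \<Gamma>"
    and gh: "\<forall>c\<in>A. \<forall>p\<in>U \<inter> cdom c. \<forall>v w. g c p v w = exp (f p) * h c p v w"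
    and \<theta>f: "\<forall>c\<in>A. \<forall>p\<in>U \<inter> cdom c. \<forall>v. \<theta> c p v = pd c p v f"
    and c: "c \<in> A" "p \<in> U \<inter> cdom c"
  shows "\<Gamma> c p u v = nabla c p u v - weyl c p u v"
proof -
  interpret P: quaternionic_unit_covector "g c p" "I1 c p" "I2 c p" "I3 c p" "\<theta> c p" "B c p"
    using point c by auto
  define a where "a u v = nabla c p u v - \<Gamma> c p u v" for u v
  have pdh: "pd c p u (\<lambda>q. h c q v w) = h c p (\<Gamma> c p u v) w + h c p v (\<Gamma> c p u w)" for u v w
    using U(4) c by (simp add: levi_civita_def parallel_bilinear_def cov_bilinear_def algebra_simps)
  have \<Gamma>_sym: "\<Gamma> c p u v = \<Gamma> c p v u" for u v
    using U(4) c by (simp add: levi_civita_def torsion_def)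
  have smf: "smooth_in c U f" and smh: "smooth_in c U (\<lambda>q. h c q v w)" for v w
    using U(2,3) c by (auto simp: smooth_fun_def riemannian_metric_def bilinear_field_def)
  have compat: "g c p (a u v) w + g c p v (a u w) = \<theta> c p u * g c p v w" for u v w
  proof -
    have "pd c p u (\<lambda>q. g c q v w) = pd c p u (\<lambda>q. exp (f q) * h c q v w)"
      by (rule pd_cong[OF chart U(1)]) (use c gh in auto)
    also have "\<dots> = exp (f p) * pd c p u (\<lambda>q. h c q v w) + exp (f p) * pd c p u f * h c p v w"
      using has_derivative_mult[OF has_pd_exp[OF chart U(1) smf] has_pd[OF chart U(1) smh], OF c(1) c(2) c(1) c(2)] c
      by (intro pd_eqI) (simp add: comp_def cinv_cmap[OF chart])
    also have "\<dots> = g c p (\<Gamma> c p u v) w + g c p v (\<Gamma> c p u w) + \<theta> c p u * g c p v w"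
      using gh \<theta>f c by (simp add: pdh algebra_simps)
    finally show ?thesis using c by (simp add: pd_g a_def P.lins)
  qed
  have a_sym: "a u v = a v u" for u v
    using c by (simp add: a_def \<Gamma>_sym[of u] nabla_sym[of c p u])
  \<comment> \<open>The sum of \<open>compat\<close> for \<open>(u, v, w)\<close> and
    \<open>(v, u, w)\<close> minus that for \<open>(w, u, v)\<close>; all other values of
    \<open>a\<close> cancel by symmetry.\<close>
  have "2 * g c p (a u v) w = \<theta> c p u * g c p v w + \<theta> c p v * g c p u w - \<theta> c p w * g c p u v" for w
    using compat[of u v w] compat[of v u w] compat[of w u v] a_sym[of u v] a_sym[of u w] a_sym[of v w]
      P.sym[of v "a w u"] P.sym[of u "a w v"] P.sym[of v u] P.sym[of v "a u w"] P.sym[of u "a v w"] by simp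
  moreover have "2 * g c p (weyl c p u v) w = \<theta> c p u * g c p v w + \<theta> c p v * g c p u w - \<theta> c p w * g c p u v" for w
    by (simp add: weyl_shift_def P.point_simps)
  ultimately have "g c p (a u v - weyl c p u v) w = 0" for w
    by (simp add: P.lins) (metis mult_left_cancel zero_neq_numeral)
  then have "a u v = weyl c p u v" using P.pos[of "a u v - weyl c p u v"] by fastforce
  then show ?thesis by (simp add: a_def algebra_simps)
qed

text \<open>Packages the local Levi-Civita connections with their common expression. The parallelism
  clause serves to differentiate the complex structures, the connection clause supplies smoothness
  for \<open>B\<close>.\<close>

lemma obata_cover:
  obtains \<U> \<Gamma> where "\<Union>\<U> = UNIV" "\<And>U. U \<in> \<U> \<Longrightarrow> open U" "\<And>U. U \<in> \<U> \<Longrightarrow> connection A U (\<Gamma> U)"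
    "\<And>U J. U \<in> \<U> \<Longrightarrow> J \<in> {I1, I2, I3} \<Longrightarrow> parallel_endo A U (\<Gamma> U) J"
    "\<And>U c p u v. U \<in> \<U> \<Longrightarrow> c \<in> A \<Longrightarrow> p \<in> U \<inter> cdom c \<Longrightarrow> \<Gamma> U c p u v = nabla c p u v - weyl c p u v"
proof -
  obtain \<U> f h where cov: "lchk_cover A g I1 I2 I3 \<U> f h" and
    \<theta>f: "\<forall>U\<in>\<U>. \<forall>c\<in>A. \<forall>p\<in>U \<inter> cdom c. \<forall>v. \<theta> c p v = pd c p v (f U)"
    using lee by (auto simp: lee_form_def)
  then have "\<forall>U\<in>\<U>. \<exists>\<Gamma>. levi_civita A U (h U) \<Gamma> \<and> (\<forall>J\<in>{I1, I2, I3}. parallel_endo A U \<Gamma> J)"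
    unfolding lchk_cover_def hyperkaehler_def by blast
  then obtain \<Gamma> where \<Gamma>: "\<And>U. U\<in>\<U> \<Longrightarrow> levi_civita A U (h U) (\<Gamma> U) \<and> (\<forall>J\<in>{I1, I2, I3}. parallel_endo A U (\<Gamma> U) J)"
    by metis
  show ?thesis
  proof (rule that[of \<U> \<Gamma>])
    fix U c p u v assume U: "U \<in> \<U>" and c: "c \<in> A" "p \<in> U \<inter> cdom c"
    show "\<Gamma> U c p u v = nabla c p u v - weyl c p u v"
      by (rule conformal_levi_civita[where U = U and f = "f U" and h = "h U"])
         (use U c cov \<theta>f \<Gamma> in \<open>auto simp: lchk_cover_def hyperkaehler_def hyperhermitian_def\<close>)
  qed (use cov \<Gamma> in \<open>auto simp: lchk_cover_def levi_civita_def\<close>)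
qed

text \<open>This is \<open>D J = 0\<close> in components. Near \<open>p\<close> the connection
  \<Gamma> is parallel for \<open>J\<close>, and \<open>D\<close> is \<Gamma> plus
  \<open>K + weyl\<close>, which commutes with \<open>J\<close>.\<close>

lemma pd_I:
  assumes "c \<in> A" "p \<in> cdom c" "J \<in> {I1, I2, I3}"
  shows "pd c p u (\<lambda>q. J c q v) = J c p (D c p u v) - D c p u (J c p v)"
proof -
  interpret P: quaternionic_unit_covector "g c p" "I1 c p" "I2 c p" "I3 c p" "\<theta> c p" "B c p"
    using point assms by auto
  obtain U \<Gamma> where "p \<in> U" and par: "parallel_endo A U \<Gamma> J"
    and \<Gamma>: "\<And>u v. \<Gamma> c p u v = nabla c p u v - weyl c p u v"
    using obata_cover assms by (metis (no_types, lifting) IntI UNIV_I UnionE)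
  then have "cov_endo \<Gamma> J c p u v = 0" using assms by (simp add: parallel_endo_def)
  then have "pd c p u (\<lambda>q. J c q v) = J c p (\<Gamma> c p u v) - \<Gamma> c p u (J c p v)"
    by (simp add: cov_endo_def cov_def algebra_simps)
  moreover
  have "K c p u (J c p v) + weyl c p u (J c p v) = J c p (K c p u v) + J c p (weyl c p u v)"
    using P.weyl_K_commutes assms(3) by (auto simp: P.lins)
  then have "K c p u (J c p v) = J c p (K c p u v) + J c p (weyl c p u v) - weyl c p u (J c p v)"
    by (simp only: eq_diff_eq)
  ultimately show ?thesis
    by (simp add: \<Gamma> D_def linear_add[OF lin_I[OF assms]] linear_diff[OF lin_I[OF assms]])
qed

text \<open>Evaluating the Weyl shift on a constant field \<open>b\<close> gives \<open>g(b, b) B\<close> in terms of smooth data.\<close>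

lemma smooth_B: assumes "c \<in> A" shows "smooth_in c UNIV (\<lambda>q. B c q)"
proof -
  obtain \<U> \<Gamma> where cov: "\<Union>\<U> = UNIV" "\<And>U. U \<in> \<U> \<Longrightarrow> open U" "\<And>U. U \<in> \<U> \<Longrightarrow> connection A U (\<Gamma> U)"
    and \<Gamma>: "\<And>U c p u v. U \<in> \<U> \<Longrightarrow> c \<in> A \<Longrightarrow> p \<in> U \<inter> cdom c \<Longrightarrow> \<Gamma> U c p u v = nabla c p u v - weyl c p u v"
    using obata_cover by metis
  have "smooth_in c U (\<lambda>q. B c q)" if U: "U \<in> \<U>" for U
  proof -
    note [intro!] = smooth_in_scaleR[OF chart[OF assms] cov(2)[OF U]] smooth_in_inverse[OF chart[OF assms] cov(2)[OF U]]
      smooth_in_diff[OF chart[OF assms] cov(2)[OF U]] smooth_in_const[OF chart[OF assms] cov(2)[OF U]]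
    obtain b :: 'e where b: "b \<in> Basis" using nonempty_Basis by blast
    have pos: "g c q b b > 0" if "q \<in> cdom c" for q
      using quaternionic_unit_covector.pos[OF point[OF assms that] nonzero_Basis[OF b]] .
    have sm: "smooth_in c U (\<lambda>q. g c q b b)" "smooth_in c U (\<lambda>q. \<theta> c q b)" "smooth_in c U (\<lambda>q. nabla c q b b)"
      by (rule smooth_in_subset[OF _ subset_UNIV], simp add: smooth_g smooth_\<theta> smooth_nabla assms)+
    have sm\<Gamma>: "smooth_in c U (\<lambda>q. \<Gamma> U c q b b)"
      using cov(3)[OF U] assms by (auto simp: connection_def)
    have eq: "B c q = inverse (g c q b b) *\<^sub>R ((2 *\<^sub>R (\<theta> c q b *\<^sub>R b)) - 2 *\<^sub>R (nabla c q b b - \<Gamma> U c q b b))"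
      if "q \<in> U \<inter> cdom c" for q
    proof -
      have "nabla c q b b - \<Gamma> U c q b b = weyl c q b b" using \<Gamma>[OF U assms that, of b b] by simp
      then have "2 *\<^sub>R (\<theta> c q b *\<^sub>R b) - 2 *\<^sub>R (nabla c q b b - \<Gamma> U c q b b) = g c q b b *\<^sub>R B c q"
        by (simp add: weyl_shift_def flip: scaleR_2)
      then show ?thesis using pos[of q] that by simp
    qed
    have "smooth_in c U (\<lambda>q. inverse (g c q b b) *\<^sub>R ((2 *\<^sub>R (\<theta> c q b *\<^sub>R b)) - 2 *\<^sub>R (nabla c q b b - \<Gamma> U c q b b)))"
      using pos sm sm\<Gamma> by fastforce
    then show ?thesis by (subst smooth_in_cong[OF chart[OF assms] cov(2)[OF U] eq])
  qed
  then show ?thesis using smooth_in_Union[OF chart[OF assms] cov(2)] cov(1) by metis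
qed

lemma smooth_IB: "c \<in> A \<Longrightarrow> J \<in> {I1, I2, I3} \<Longrightarrow> smooth_in c UNIV (\<lambda>q. J c q (B c q))"
  by (rule smooth_in_contract[OF chart open_UNIV]) (simp_all only: smooth_I smooth_B lin_I Int_iff)

section \<open>Tensors preserved by \<open>D\<close>\<close>

lemma pd_\<theta>_D: "c \<in> A \<Longrightarrow> p \<in> cdom c \<Longrightarrow> pd c p u (\<lambda>q. \<theta> c q v) = \<theta> c p (D c p u v)"
proof -
  assume c: "c \<in> A" "p \<in> cdom c"
  interpret P: quaternionic_unit_covector "g c p" "I1 c p" "I2 c p" "I3 c p" "\<theta> c p" "B c p"
    using point c by auto
  show ?thesis using c by (simp add: pd_\<theta> D_def P.lins P.\<theta>_K)
qed

text \<open>\<open>D\<close> preserves \<theta> and \<open>J\<close>, hence their contraction: in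
  the Leibniz rule the two terms with \<open>D u (J v)\<close> cancel.\<close>

lemma pd_\<theta>I:
  assumes "c \<in> A" "p \<in> cdom c" "J \<in> {I1, I2, I3}"
  shows "pd c p u (\<lambda>q. \<theta> c q (J c q v)) = \<theta> c p (J c p (D c p u v))"
proof -
  interpret P: quaternionic_unit_covector "g c p" "I1 c p" "I2 c p" "I3 c p" "\<theta> c p" "B c p"
    using point assms by auto
  have "pd c p u (\<lambda>q. \<theta> c q (J c q v)) = pd c p u (\<lambda>q. \<theta> c q (J c p v)) + \<theta> c p (pd c p u (\<lambda>q. J c q v))"
    by (rule pd_contract[OF chart open_UNIV]) (use assms in \<open>simp_all only: smooth_\<theta> smooth_I lin_\<theta> Int_iff UNIV_I simp_thms\<close>)
  then show ?thesis using assms by (simp only: pd_\<theta>_D pd_I) (simp add: P.lins)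
qed

lemma pd_g_D:
  assumes "c \<in> A" "p \<in> cdom c"
  shows "pd c p u (\<lambda>q. g c q v w) = g c p (D c p u v) w + g c p v (D c p u w)"
proof -
  interpret P: quaternionic_unit_covector "g c p" "I1 c p" "I2 c p" "I3 c p" "\<theta> c p" "B c p"
    using point assms by auto
  show ?thesis using assms P.K_skew[of u v w] by (simp add: pd_g D_def P.lins)
qed

text \<open>The metric \<open>ghat\<close> is polynomial in \<open>g\<close>, \<theta> and the
  \<open>\<theta> \<circ> I\<^sub>r\<close>, each of which \<open>D\<close> preserves.\<close>

lemma pd_ghat:
  assumes "c \<in> A" "p \<in> cdom c"
  shows "pd c p u (\<lambda>q. ghat c q v w) = ghat c p (D c p u v) w + ghat c p v (D c p u w)"
proof -
  have p: "p \<in> UNIV \<inter> cdom c" using assms by simp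
  note pds = pd_add[OF chart[OF assms(1)] open_UNIV _ _ p] pd_diff[OF chart[OF assms(1)] open_UNIV _ _ p]
    pd_mult[OF chart[OF assms(1)] open_UNIV _ _ p] pd_const
    smooth_in_add[OF chart[OF assms(1)] open_UNIV] smooth_in_mult[OF chart[OF assms(1)] open_UNIV]
    smooth_in_const[OF chart[OF assms(1)] open_UNIV] smooth_\<theta> smooth_\<theta>I smooth_g pd_\<theta>_D pd_\<theta>I pd_g_D
  show ?thesis unfolding ghat_def hkt_ghat_def
    by (simp only: pds assms insert_iff simp_thms) (simp add: algebra_simps)
qed

section \<open>Coordinate changes and smoothness of \<open>K\<close> and \<open>ghat\<close>\<close>

lemma riemannian_transforms:
  assumes "c \<in> A" "d \<in> A" "p \<in> cdom c \<inter> cdom d"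
  shows transform_g: "g d p (jac c d p v) (jac c d p w) = g c p v w"
    and transform_\<theta>: "\<theta> d p (jac c d p v) = \<theta> c p v"
    and transform_I: "I1 d p (jac c d p v) = jac c d p (I1 c p v)"
      "I2 d p (jac c d p v) = jac c d p (I2 c p v)" "I3 d p (jac c d p v) = jac c d p (I3 c p v)"
    and transform_B: "B d p = jac c d p (B c p)"
proof -
  note lj = linear_jac[OF atlas assms]
  show transform_g: "g d p (jac c d p v) (jac c d p w) = g c p v w" for v w
    using herm assms by (simp add: hyperhermitian_def riemannian_metric_def bilinear_field_def)
  show transform_\<theta>: "\<theta> d p (jac c d p v) = \<theta> c p v" for v
    using lee assms by (simp add: lee_form_def one_form_def)
  show "I1 d p (jac c d p v) = jac c d p (I1 c p v)"
      "I2 d p (jac c d p v) = jac c d p (I2 c p v)" "I3 d p (jac c d p v) = jac c d p (I3 c p v)"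
    using herm assms linear_neg[OF lj]
    by (simp_all add: hyperhermitian_def hypercomplex_def complex_structure_def endo_field_def)
  interpret P: quaternionic_unit_covector "g c p" "I1 c p" "I2 c p" "I3 c p" "\<theta> c p" "B c p"
    using point assms by simp
  interpret Q: quaternionic_unit_covector "g d p" "I1 d p" "I2 d p" "I3 d p" "\<theta> d p" "B d p"
    using point assms by simp
  \<comment> \<open>The Jacobian is an isometry between positive definite forms. Its bijectivity
    lets every vector in \<open>d\<close> be written as an image when testing \<open>B\<close>
    below.\<close>
  have "inj (jac c d p)"
    unfolding linear_injective_0[OF lj]
  proof (intro allI impI)
    fix v assume "jac c d p v = 0"
    then have "g c p v v = 0" using transform_g[of v v] by (simp add: bilinear_lzero[OF Q.bil])
    then show "v = 0" using P.pos[of v] by (cases "v = 0") auto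
  qed
  then have surj: "surj (jac c d p)" by (rule linear_injective_imp_surjective[OF lj]) (rule refl)
  \<comment> \<open>\<open>B\<close> is given by a description in each chart separately, so its
    transformation law follows from uniqueness: both vectors represent \<theta> under the
    nondegenerate \<open>g\<close>.\<close>
  have "g d p (B d p - jac c d p (B c p)) w = 0" for w
  proof -
    obtain w' where "w = jac c d p w'" using surj by (rule surjE)
    then show ?thesis by (simp add: Q.lins Q.gB transform_g transform_\<theta> P.gB)
  qed
  then have "B d p - jac c d p (B c p) = 0"
    using Q.pos[of "B d p - jac c d p (B c p)"] by (cases "B d p - jac c d p (B c p) = 0") simp_all
  then show "B d p = jac c d p (B c p)" by simp
qed

text \<open>\<open>K\<close> is built from tensors alone, so it transforms without a
  second-derivative term; the \<open>hess\<close> term in the law for \<open>D\<close> comes from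
  \<open>nabla\<close>.\<close>

lemma transform_K:
  assumes "c \<in> A" "d \<in> A" "p \<in> cdom c \<inter> cdom d"
  shows "K d p (jac c d p v) (jac c d p w) = jac c d p (K c p v w)"
proof -
  note lj = linear_jac[OF atlas assms]
  show ?thesis
    unfolding hkt_shift_def
    by (simp only: riemannian_transforms[OF assms] linear_add[OF lj] linear_diff[OF lj] linear_scale[OF lj])
qed

lemma transform_ghat:
  assumes "c \<in> A" "d \<in> A" "p \<in> cdom c \<inter> cdom d"
  shows "ghat d p (jac c d p v) (jac c d p w) = ghat c p v w"
  unfolding ghat_def hkt_ghat_def by (simp only: riemannian_transforms[OF assms])

lemma smooth_ghat:
  assumes "c \<in> A" shows "smooth_in c UNIV (\<lambda>q. ghat c q v w)"
  unfolding ghat_def hkt_ghat_def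
  by (intro smooth_in_diff[OF chart[OF assms] open_UNIV] smooth_in_mult[OF chart[OF assms] open_UNIV]
      smooth_in_add[OF chart[OF assms] open_UNIV] smooth_in_const[OF chart[OF assms] open_UNIV]
      smooth_g[OF assms] smooth_\<theta>[OF assms] smooth_\<theta>I[OF assms, of I1] smooth_\<theta>I[OF assms, of I2] smooth_\<theta>I[OF assms, of I3]) simp_all

lemma smooth_K:
  assumes "c \<in> A" shows "smooth_in c UNIV (\<lambda>q. K c q v w)"
  unfolding hkt_shift_def
  by (intro smooth_in_diff[OF chart[OF assms] open_UNIV] smooth_in_mult[OF chart[OF assms] open_UNIV]
      smooth_in_scaleR[OF chart[OF assms] open_UNIV]
      smooth_in_add[OF chart[OF assms] open_UNIV] smooth_in_const[OF chart[OF assms] open_UNIV]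
      smooth_\<theta>[OF assms] smooth_\<theta>I[OF assms, of I1] smooth_\<theta>I[OF assms, of I2] smooth_\<theta>I[OF assms, of I3]
      smooth_I[OF assms, of I1] smooth_I[OF assms, of I2] smooth_I[OF assms, of I3] smooth_B[OF assms]
      smooth_gI[OF assms, of I1] smooth_gI[OF assms, of I2] smooth_gI[OF assms, of I3]
      smooth_IB[OF assms, of I1] smooth_IB[OF assms, of I2] smooth_IB[OF assms, of I3]) simp_all

section \<open>\<open>ghat\<close> as an HKT metric with connection \<open>D\<close>\<close>

lemma hyperhermitian_ghat: "hyperhermitian A UNIV ghat I1 I2 I3"
proof -
  have "bilinear (ghat c p)" "ghat c p v w = ghat c p w v" "v \<noteq> 0 \<Longrightarrow> ghat c p v v > 0"
    "J \<in> {I1, I2, I3} \<Longrightarrow> ghat c p (J c p v) (J c p w) = ghat c p v w" if c: "c \<in> A" "p \<in> cdom c" for J c p v w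
  proof -
    interpret P: quaternionic_unit_covector "g c p" "I1 c p" "I2 c p" "I3 c p" "\<theta> c p" "B c p"
      by (rule point[OF c])
    have [simp]: "ghat c p = P.ghat" by (intro ext) (simp add: ghat_def)
    show "bilinear (ghat c p)" by (simp add: P.ghat_bilinear)
    show "ghat c p v w = ghat c p w v" by (simp add: P.ghat_sym)
    show "v \<noteq> 0 \<Longrightarrow> ghat c p v v > 0" by (simp add: P.ghat_pos)
    show "J \<in> {I1, I2, I3} \<Longrightarrow> ghat c p (J c p v) (J c p w) = ghat c p v w"
      by (elim insertE) (simp_all add: P.ghat_herm)
  qed
  moreover have "hypercomplex A UNIV I1 I2 I3" using herm by (simp add: hyperhermitian_def)
  ultimately show ?thesis
    unfolding hyperhermitian_def riemannian_metric_def bilinear_field_def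
    by (intro conjI ballI allI impI) (simp_all only: smooth_ghat transform_ghat Int_iff UNIV_I simp_thms)
qed

lemma torsion_D: "c \<in> A \<Longrightarrow> p \<in> cdom c \<Longrightarrow> torsion D c p v w = K c p v w - K c p w v"
  by (simp add: torsion_def D_def nabla_sym[of c p v w])

lemma connection_D: "connection A UNIV D"
  unfolding connection_def
proof (intro ballI conjI allI)
  fix c p assume c: "c \<in> A" "p \<in> UNIV \<inter> cdom c"
  interpret P: quaternionic_unit_covector "g c p" "I1 c p" "I2 c p" "I3 c p" "\<theta> c p" "B c p"
    using point c by simp
  have "bilinear (nabla c p)" using lc c by (simp add: levi_civita_def connection_def)
  then show "bilinear (D c p)"
    using P.K_bilinear by (simp add: bilinear_def linear_iff D_def scaleR_add_right)
next
  fix c v w assume c: "c \<in> A"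
  show "smooth_in c UNIV (\<lambda>p. D c p v w)"
    unfolding D_def by (intro smooth_in_add[OF chart[OF c] open_UNIV] smooth_nabla[OF c] smooth_K[OF c])
next
  fix c d p v w assume c: "c \<in> A" "d \<in> A" "p \<in> UNIV \<inter> cdom c \<inter> cdom d"
  then have "nabla d p (jac c d p v) (jac c d p w) = jac c d p (nabla c p v w) - hess c d p v w"
    using lc by (simp add: levi_civita_def connection_def)
  then show "D d p (jac c d p v) (jac c d p w) = jac c d p (D c p v w) - hess c d p v w"
    using c by (simp add: D_def transform_K linear_add[OF linear_jac[OF atlas]])
qed

lemma hkt_connection_D: "hkt_connection A ghat I1 I2 I3 D"
  unfolding hkt_connection_def
proof (intro conjI connection_D ballI)
  show "parallel_bilinear A UNIV D ghat"
    by (simp add: parallel_bilinear_def cov_bilinear_def pd_ghat)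
next
  fix J assume J: "J \<in> {I1, I2, I3}"
  show "parallel_endo A UNIV D J"
    unfolding parallel_endo_def cov_endo_def cov_const cov_def
    by (intro ballI allI) (simp add: pd_I[OF _ _ J])
next
  have T: "bilinear (\<lambda>w z. ghat c p (torsion D c p v w) z)" "linear (\<lambda>v. ghat c p (torsion D c p v w) z)"
    "ghat c p (torsion D c p w v) z = - ghat c p (torsion D c p v w) z"
    "ghat c p (torsion D c p v z) w = - ghat c p (torsion D c p v w) z"
    if c: "c \<in> A" "p \<in> cdom c" for c p v w z
  proof -
    interpret P: quaternionic_unit_covector "g c p" "I1 c p" "I2 c p" "I3 c p" "\<theta> c p" "B c p"
      by (rule point[OF c])
    have [simp]: "ghat c p = P.ghat" by (intro ext) (simp add: ghat_def)
    note lins = bilinear_ladd[OF P.K_bilinear] bilinear_radd[OF P.K_bilinear]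
      bilinear_lmul[OF P.K_bilinear] bilinear_rmul[OF P.K_bilinear]
      bilinear_ladd[OF P.ghat_bilinear] bilinear_radd[OF P.ghat_bilinear]
      bilinear_lsub[OF P.ghat_bilinear]
      bilinear_lmul[OF P.ghat_bilinear] bilinear_rmul[OF P.ghat_bilinear]
    show "bilinear (\<lambda>w z. ghat c p (torsion D c p v w) z)"
      by (simp add: bilinear_def linear_iff torsion_D[OF c] lins algebra_simps)
    show "linear (\<lambda>v. ghat c p (torsion D c p v w) z)"
      by (simp add: linear_iff torsion_D[OF c] lins algebra_simps)
    show "ghat c p (torsion D c p w v) z = - ghat c p (torsion D c p v w) z"
      by (simp add: torsion_D[OF c] lins)
    show "ghat c p (torsion D c p v z) w = - ghat c p (torsion D c p v w) z"
      using P.torsion_skew[of v z w] by (simp add: torsion_D[OF c])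
  qed
  have sm: "smooth_in c UNIV (\<lambda>p. ghat c p (torsion D c p v w) z)" if c: "c \<in> A" for c v w z
  proof -
    have "smooth_in c UNIV (\<lambda>q. K c q v w - K c q w v)"
      by (intro smooth_in_diff[OF chart[OF c] open_UNIV] smooth_K[OF c])
    \<comment> \<open>The formula for the torsion holds only on the chart domain, which is all that
      \<open>smooth_in\<close> looks at.\<close>
    then have sT: "smooth_in c UNIV (\<lambda>q. torsion D c q v w)"
      using smooth_in_cong[OF chart[OF c] open_UNIV, of "\<lambda>q. torsion D c q v w" "\<lambda>q. K c q v w - K c q w v"]
        torsion_D[OF c] by simp
    have lin: "linear (\<lambda>x. ghat c q x z)" if "q \<in> UNIV \<inter> cdom c" for q
      using hyperhermitian_ghat c that
      by (simp add: hyperhermitian_def riemannian_metric_def bilinear_field_def bilinear_def)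
    show ?thesis
      by (rule smooth_in_contract[OF chart[OF c] open_UNIV lin smooth_ghat[OF c] sT])
  qed
  have tr: "ghat d p (torsion D d p (jac c d p v) (jac c d p w)) (jac c d p z) = ghat c p (torsion D c p v w) z"
    if c: "c \<in> A" "d \<in> A" "p \<in> cdom c \<inter> cdom d" for c d p v w z
    using c by (simp add: torsion_D transform_K transform_ghat flip: linear_diff[OF linear_jac[OF atlas]])
  show "three_form A UNIV (\<lambda>c p X Y Z. ghat c p (torsion D c p X Y) Z)"
    unfolding three_form_def
  proof (intro ballI conjI allI)
    fix c p v w z assume "c \<in> A" "p \<in> UNIV \<inter> cdom c"
    then have c: "c \<in> A" "p \<in> cdom c" by simp_all
    show "bilinear (\<lambda>w z. ghat c p (torsion D c p v w) z)" by (rule T(1)[OF c])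
    show "linear (\<lambda>v. ghat c p (torsion D c p v w) z)" by (rule T(2)[OF c])
    show "ghat c p (torsion D c p w v) z = - ghat c p (torsion D c p v w) z" by (rule T(3)[OF c])
    show "ghat c p (torsion D c p v z) w = - ghat c p (torsion D c p v w) z" by (rule T(4)[OF c])
  next
    fix c v w z assume "c \<in> A"
    then show "smooth_in c UNIV (\<lambda>p. ghat c p (torsion D c p v w) z)" by (rule sm)
  next
    fix c d p v w z assume "c \<in> A" "d \<in> A" "p \<in> UNIV \<inter> cdom c \<inter> cdom d"
    then show "ghat d p (torsion D d p (jac c d p v) (jac c d p w)) (jac c d p z)
        = ghat c p (torsion D c p v w) z"
      by (intro tr) simp_all
  qed
qed

section \<open>Uniqueness of the HKT connection\<close>

text \<open>The difference \<open>E\<close> of two HKT connections satisfies the algebraic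
  conditions of \<open>skew_torsion_unique\<close> with \<open>J = I1\<close>, and so
  vanishes.\<close>

lemma hkt_connection_unique:
  assumes D': "hkt_connection A ghat I1 I2 I3 D'" and c: "c \<in> A" "p \<in> cdom c"
  shows "D' c p u v = D c p u v"
proof -
  define E where "E u v = D' c p u v - D c p u v" for u v
  have bil: "bilinear (ghat c p)" and sym: "\<And>v w. ghat c p v w = ghat c p w v"
    and pos: "\<And>v. v \<noteq> 0 \<Longrightarrow> ghat c p v v > 0"
    and J: "\<And>v w. ghat c p (I1 c p v) (I1 c p w) = ghat c p v w"
    using hyperhermitian_ghat c
    by (simp_all add: hyperhermitian_def riemannian_metric_def bilinear_field_def)
  have sq: "I1 c p (I1 c p v) = - v" for v
    by (rule quaternionic_unit_covector.sq[OF point[OF c]])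
  \<comment> \<open>This and the next two facts are stated for an arbitrary HKT connection, then
    instantiated with \<open>D'\<close> and \<open>D\<close> and subtracted; the \<open>pd\<close>
    terms are the same for both and drop out.\<close>
  have torsion_skew: "ghat c p (torsion D'' c p u v) w = - ghat c p (torsion D'' c p u w) v"
    if "hkt_connection A ghat I1 I2 I3 D''" for D'' u v w
  proof -
    have "three_form A UNIV (\<lambda>c p X Y Z. ghat c p (torsion D'' c p X Y) Z)"
      using that by (simp add: hkt_connection_def)
    then show ?thesis using c unfolding three_form_def by blast
  qed
  have compat: "pd c p u (\<lambda>q. ghat c q v w) = ghat c p (D'' c p u v) w + ghat c p v (D'' c p u w)"
    if "hkt_connection A ghat I1 I2 I3 D''" for D'' u v w
    using that c by (simp add: hkt_connection_def parallel_bilinear_def cov_bilinear_def algebra_simps)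
  have pdI: "pd c p u (\<lambda>q. I1 c q v) = I1 c p (D'' c p u v) - D'' c p u (I1 c p v)"
    if "hkt_connection A ghat I1 I2 I3 D''" for D'' u v
  proof -
    have "cov_endo D'' I1 c p u v = 0" using that c by (simp add: hkt_connection_def parallel_endo_def)
    then show ?thesis by (simp add: cov_endo_def cov_def algebra_simps)
  qed
  have "E u v = 0"
  proof (rule skew_torsion_unique[where h = "ghat c p" and E = E and J = "I1 c p", OF bil sym pos])
    show "ghat c p (E u v) w + ghat c p v (E u w) = 0" for u v w
      using compat[OF D', of u v w] compat[OF hkt_connection_D, of u v w]
      by (simp add: E_def bilinear_lsub[OF bil] bilinear_rsub[OF bil])
    show "ghat c p (E u v - E v u) w = - ghat c p (E u w - E w u) v" for u v w
      using torsion_skew[OF D', of u v w] torsion_skew[OF hkt_connection_D, of u v w]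
      by (simp add: E_def torsion_def bilinear_lsub[OF bil])
    have "bilinear (D' c p)" "bilinear (D c p)"
      using D' connection_D c by (simp_all add: hkt_connection_def connection_def)
    then show "E u (- v) = - E u v" for u v
      by (simp add: E_def bilinear_rneg)
    show "E u (I1 c p v) = I1 c p (E u v)" for u v
      using pdI[OF D', of u v] pdI[OF hkt_connection_D, of u v]
      by (simp add: E_def linear_diff[OF quaternionic_unit_covector.lin(1)[OF point[OF c]]] algebra_simps)
  qed (use J sq in simp_all)
  then show ?thesis by (simp add: E_def)
qed

section \<open>The potential 1-form and the parallelism of \<theta>\<close>

text \<open>The quaternion relations hold only at points of the chart domain, so composite forms can
  be simplified under \<open>ext_d\<close> only through such a local congruence.\<close>

lemma ext_d_cong:
  assumes "c \<in> A" "p \<in> cdom c" "\<And>q v. q \<in> cdom c \<Longrightarrow> \<alpha> c q v = \<beta> c q v"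
  shows "ext_d \<alpha> c p v w = ext_d \<beta> c p v w"
proof -
  have "pd c p v (\<lambda>q. \<alpha> c q w) = pd c p v (\<lambda>q. \<beta> c q w)" for v w
    by (rule pd_cong[OF chart[OF assms(1)] open_UNIV]) (use assms in simp_all)
  then show ?thesis using assms by (simp add: ext_d_def)
qed

text \<open>By \<open>pd_\<theta>I\<close> the derivatives are values of \<open>D\<close>;
  antisymmetrising removes the symmetric \<open>nabla\<close> and leaves \<open>K\<close>.\<close>

lemma ext_d_\<theta>I:
  assumes "c \<in> A" "p \<in> cdom c" "J \<in> {I1, I2, I3}"
  shows "ext_d (\<lambda>c p v. \<theta> c p (J c p v)) c p v w = \<theta> c p (J c p (K c p v w - K c p w v))"
proof -
  note l = linear_diff[OF lin_I[OF assms]] linear_diff[OF lin_\<theta>[OF assms(1,2)]]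
    linear_add[OF lin_I[OF assms]] linear_add[OF lin_\<theta>[OF assms(1,2)]] linear_0[OF lin_I[OF assms]]
    linear_0[OF lin_\<theta>[OF assms(1,2)]]
  show ?thesis unfolding ext_d_def lie_const pd_\<theta>I[OF assms]
    by (simp add: l D_def nabla_sym[OF assms(1,2), of v w])
qed

lemma potential_ghat: "potential_one_form A ghat I1 I2 I3 (\<lambda>c p v. - \<theta> c p v)"
  unfolding potential_one_form_def
proof (intro conjI ballI allI)
  have lee1: "one_form A UNIV \<theta>" using lee by (simp add: lee_form_def)
  have "linear (\<lambda>v. - \<theta> c p v)" if "c \<in> A" "p \<in> cdom c" for c p
    using linear_compose_neg[OF lin_\<theta>[OF that]] .
  moreover have "smooth_in c UNIV (\<lambda>p. - \<theta> c p v)" if "c \<in> A" for c v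
    by (rule smooth_in_uminus[OF chart[OF that] open_UNIV smooth_\<theta>[OF that]])
  ultimately show "one_form A UNIV (\<lambda>c p v. - \<theta> c p v)"
    using lee1 unfolding one_form_def by simp
next
  fix c p v w assume c: "c \<in> A" "p \<in> cdom c"
  interpret P: quaternionic_unit_covector "g c p" "I1 c p" "I2 c p" "I3 c p" "\<theta> c p" "B c p"
    by (rule point[OF c])
  have act: "act1 J (\<lambda>c p v. - \<theta> c p v) = (\<lambda>c p v. \<theta> c p (J c p v))" for J
    by (simp add: act1_def)
  \<comment> \<open>The two signs of \<open>act1\<close> cancel, leaving
    \<open>- \<theta> \<circ> L \<circ> J\<close>; the quaternion relation \<open>L J = - N\<close>
    turns this into \<open>\<theta> \<circ> N\<close>.\<close>
  have d: "ext_d (act1 J (act1 L (\<lambda>c p v. - \<theta> c p v))) c p v w = \<theta> c p (N c p (K c p v w - K c p w v))"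
    if "\<And>q v. q \<in> cdom c \<Longrightarrow> L c q (J c q v) = - N c q v" and N: "N \<in> {I1, I2, I3}" for J L N v w
  proof -
    have "ext_d (act1 J (act1 L (\<lambda>c p v. - \<theta> c p v))) c p v w = ext_d (\<lambda>c p v. \<theta> c p (N c p v)) c p v w"
      by (rule ext_d_cong[OF c]) (simp add: act1_def that(1) linear_neg[OF lin_\<theta>[OF c(1)]])
    then show ?thesis by (simp only: ext_d_\<theta>I[OF c N])
  qed
  have q: "I3 c q (I2 c q v) = - I1 c q v" "I1 c q (I3 c q v) = - I2 c q v" "I2 c q (I1 c q v) = - I3 c q v"
    if "q \<in> cdom c" for q v
    using quaternionic_unit_covector.quaternion[OF point[OF c(1) that]]
      quaternionic_unit_covector.I21[OF point[OF c(1) that]] by simp_all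
  note simps = fund_form_def twisted_d_def act2_def
    d[where L = I3 and J = I2 and N = I1, OF q(1)] d[where L = I1 and J = I3 and N = I2, OF q(2)]
    d[where L = I2 and J = I1 and N = I3, OF q(3)]
  have [simp]: "ghat c p = P.ghat" by (intro ext) (simp add: ghat_def)
  show "fund_form ghat I1 c p v w = 1/2 * (ext_d (act1 I1 (\<lambda>c p v. - \<theta> c p v)) c p v w
      + twisted_d I2 (act1 I3 (\<lambda>c p v. - \<theta> c p v)) c p v w)"
    by (simp add: simps act[of I1] ext_d_\<theta>I[OF c] P.potential(1))
  show "fund_form ghat I2 c p v w = 1/2 * (ext_d (act1 I2 (\<lambda>c p v. - \<theta> c p v)) c p v w
      + twisted_d I3 (act1 I1 (\<lambda>c p v. - \<theta> c p v)) c p v w)"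
    by (simp add: simps act[of I2] ext_d_\<theta>I[OF c] P.potential(2))
  show "fund_form ghat I3 c p v w = 1/2 * (ext_d (act1 I3 (\<lambda>c p v. - \<theta> c p v)) c p v w
      + twisted_d I1 (act1 I2 (\<lambda>c p v. - \<theta> c p v)) c p v w)"
    by (simp add: simps act[of I3] ext_d_\<theta>I[OF c] P.potential(3))
qed

text \<open>Uniqueness replaces the given connection by \<open>D\<close>, for which
  \<open>pd_\<theta>_D\<close> is exactly the vanishing of the covariant derivative of
  \<theta>.\<close>

lemma parallel_\<theta>:
  assumes "hkt_connection A ghat I1 I2 I3 D'"
  shows "parallel_form A UNIV D' \<theta>"
  by (simp add: parallel_form_def cov_form_def pd_\<theta>_D hkt_connection_unique[OF assms])

end

theorem theorem17:
  fixes A :: "('m::{t2_space, second_countable_topology}, 'e::euclidean_space) chart set"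
    and g ghat :: "('m, 'e) tensor2"
    and I1 I2 I3 :: "('m, 'e) endo"
    and \<theta> \<theta>1 \<theta>2 \<theta>3 :: "('m, 'e) tensor1"
    and nabla :: "('m, 'e) conn"
  assumes "smooth_atlas A"
    and "lc_hyperkaehler A g I1 I2 I3"
    and "lee_form A g I1 I2 I3 \<theta>"
    and "levi_civita A UNIV g nabla"
    and "parallel_form A UNIV nabla \<theta>"
    and "\<forall>c\<in>A. \<forall>p\<in>cdom c. form_norm g \<theta> c p = 1"
    and "\<theta>1 = act1 I1 \<theta>" and "\<theta>2 = act1 I2 \<theta>" and "\<theta>3 = act1 I3 \<theta>"
    and "ghat = (\<lambda>c p v w. g c p v w - 1/2 *
           (\<theta> c p v * \<theta> c p w + \<theta>1 c p v * \<theta>1 c p w + \<theta>2 c p v * \<theta>2 c p w + \<theta>3 c p v * \<theta>3 c p w))"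
  shows "hkt_metric A ghat I1 I2 I3
    \<and> potential_one_form A ghat I1 I2 I3 (\<lambda>c p v. - \<theta> c p v)
    \<and> (\<forall>D. hkt_connection A ghat I1 I2 I3 D \<longrightarrow> parallel_form A UNIV D \<theta>)"
proof -
  interpret unit_parallel_lee A g I1 I2 I3 \<theta> nabla
    using assms(1-6) by unfold_locales (simp_all add: lc_hyperkaehler_def)
  \<comment> \<open>Identifies the metric written with \<theta>1, \<theta>2, \<theta>3 with the one
    of the locale; the minus signs of \<open>act1\<close> occur squared.\<close>
  have "ghat = local.ghat"
    unfolding assms(7-10) by (intro ext) (simp add: ghat_def hkt_ghat_def act1_def)
  then show ?thesis
    using hyperhermitian_ghat hkt_connection_D potential_ghat parallel_\<theta> by (auto simp: hkt_metric_def)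
qed

end
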